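(* Let $n\ge1$, $n'=\lfloor n/2\rfloor$. Then $R_n$ is a free $R_n^{odd}$-module with basis $\{h_{2i_1}h_{2i_2}\cdots h_{2i_{n'}}\mid 0\le i_1\le i_2\le\dots\le i_{n'}\}$: $$R_n=\bigoplus_{0\le i_1\le\dots\le i_{n'}}R_n^{odd}\,h_{2i_1}\cdots h_{2i_{n'}}.$$
   Context: $R_n=\mathbb C[x_1,\dots,x_n]^{S_n}$ is the ring of symmetric polynomials. $p_k=\sum_{j=1}^nx_j^k$ are power sums, $h_k$ the complete homogeneous symmetric polynomials in $x_1,\dots,x_n$ ($h_0=1$). $R_n^{odd}=\mathbb C[p_{2j+1}\mid 0\le j\le (n-1)/2]\subset R_n$. *)

theory Defs
  imports Complex_Main "HOL-Library.Poly_Mapping" "HOL-Library.Multiset" "HOL-Combinatorics.Permutations"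
begin

text \<open>Multivariate polynomials over the complex numbers in variables x_0, x_1, ...:
  a monomial is a finitely supported exponent vector, a polynomial is a finitely supported
  coefficient function on monomials (convolution product from HOL-Library.Poly_Mapping).
  The paper's variables x_1..x_n are x_0..x_(n-1) here.\<close>

type_synonym mpoly = "(nat \<Rightarrow>\<^sub>0 nat) \<Rightarrow>\<^sub>0 complex"

definition const_mp :: "complex \<Rightarrow> mpoly" where
  "const_mp c = Poly_Mapping.single 0 c"

definition var :: "nat \<Rightarrow> mpoly" where
  "var i = Poly_Mapping.single (Poly_Mapping.single i 1) 1"

definition mdeg :: "(nat \<Rightarrow>\<^sub>0 nat) \<Rightarrow> nat" where
  "mdeg m = (\<Sum>i\<in>Poly_Mapping.keys m. Poly_Mapping.lookup m i)"

definition perm_mono :: "(nat \<Rightarrow> nat) \<Rightarrow> (nat \<Rightarrow>\<^sub>0 nat) \<Rightarrow> (nat \<Rightarrow>\<^sub>0 nat)" where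
  "perm_mono \<sigma> m = (\<Sum>i\<in>Poly_Mapping.keys m. Poly_Mapping.single (\<sigma> i) (Poly_Mapping.lookup m i))"

definition Rn :: "nat \<Rightarrow> mpoly set" where
  "Rn n = {p. (\<forall>m\<in>Poly_Mapping.keys p. Poly_Mapping.keys m \<subseteq> {..<n}) \<and>
              (\<forall>\<sigma>. \<sigma> permutes {..<n} \<longrightarrow> (\<forall>m. Poly_Mapping.lookup p (perm_mono \<sigma> m) = Poly_Mapping.lookup p m))}"

definition psum :: "nat \<Rightarrow> nat \<Rightarrow> mpoly" where
  "psum n k = (\<Sum>i<n. var i ^ k)"

definition hcomp :: "nat \<Rightarrow> nat \<Rightarrow> mpoly" where
  "hcomp n k = (\<Sum>m\<in>{m. Poly_Mapping.keys m \<subseteq> {..<n} \<and> mdeg m = k}. Poly_Mapping.single m 1)"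

inductive_set Rodd :: "nat \<Rightarrow> mpoly set" for n :: nat where
  const: "const_mp c \<in> Rodd n"
| gen: "j \<le> (n - 1) div 2 \<Longrightarrow> psum n (2 * j + 1) \<in> Rodd n"
| add: "p \<in> Rodd n \<Longrightarrow> q \<in> Rodd n \<Longrightarrow> p + q \<in> Rodd n"
| mult: "p \<in> Rodd n \<Longrightarrow> q \<in> Rodd n \<Longrightarrow> p * q \<in> Rodd n"

text \<open>Basis element h_(2 i_1) ... h_(2 i_n') indexed by the multiset {i_1,...,i_n'}
  (a multiset of size n' is the same as a nondecreasing sequence i_1 <= ... <= i_n').\<close>
definition hbasis :: "nat \<Rightarrow> nat multiset \<Rightarrow> mpoly" where
  "hbasis n M = (\<Prod>i\<in>#M. hcomp n (2 * i))"

end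

(* R_n is generated by the power sums.  Modulo the odd power sums, the generating functions E and H
   are even, and E(-t) H(t) = 1 makes the even h_k satisfy a linear recurrence of order m = n div 2.
   Hence the Jacobi-Trudi type determinants det (h_{2 (l_i - i + j)}) of size m + 1 vanish modulo the
   odd power sums, which rewrites a product of m + 1 even h's through products of m of them.  With
   the graded Nakayama lemma the proposed basis spans R_n over R_n^odd.

   Linear independence follows by counting in each degree: (odd-part multiset, basis index) pairs
   inject, by conjugation of partitions, into the partitions with at most n parts, and these index
   the linearly independent orbit sums of R_n. *)

theory Submission
  imports Defs "HOL-Computational_Algebra.Formal_Power_Series" "Jordan_Normal_Form.Determinant"
begin

text \<open>Freeness is reduced to complex linear algebra. The products of a monomial in the odd
  power sums with a proposed basis element form a family indexed by pairs, and it is shown to be a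
  complex basis. Its independence contains the algebraic independence of the odd power sums; both
  come out of the same count, since a spanning set with no more members than some independent set is
  itself independent.

  The number n div 2 stems from e_k = 0 for k > n. The same fact removes an obstacle: only the p_k
  with odd k at most n are generators, while h_k is nonzero for arbitrarily large k, so Newton's
  identity for h leads out of the allowed generators. The odd e_k are therefore treated before the
  odd h_k, which then follow from E(-t) H(t) = 1.

  The determinants vanish because their columns satisfy one linear relation, the recurrence, whose
  coefficients do not depend on the row and include e_0 = 1; the adjugate matrix turns this into an
  identity without a quotient ring. The diagonal term is the product to be rewritten. Every other
  nonzero term has its parts further apart, and this makes the rewriting stop.\<close>

lemma const_mp_0 [simp]: "const_mp 0 = 0"
  and const_mp_1 [simp]: "const_mp 1 = 1"
  and const_mp_add: "const_mp (a + b) = const_mp a + const_mp b"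
  and const_mp_mult: "const_mp (a * b) = const_mp a * const_mp b"
  and const_mp_uminus: "const_mp (- a) = - const_mp a"
  by (simp_all add: const_mp_def single_add mult_single single_uminus)

lemma const_mp_of_nat: "const_mp (of_nat k) = of_nat k"
  by (simp add: const_mp_def)

lemma lookup_const_mp_mult [simp]:
  "Poly_Mapping.lookup (const_mp c * p) m = c * Poly_Mapping.lookup p m"
proof -
  have "const_mp c * p = Poly_Mapping.map ((*) c) p"
    by (simp add: const_mp_def mult_map_scale_conv_mult)
  thus ?thesis by (simp add: Poly_Mapping.map.rep_eq when_def)
qed

lemma const_mp_inverse_mult: "c \<noteq> 0 \<Longrightarrow> const_mp (inverse c) * (const_mp c * p) = p"
  by (simp add: mult.assoc [symmetric] const_mp_mult [symmetric])

text \<open>Packaged as a scalar action so that span, independence and the exchange lemma of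
  \<open>vector_space\<close> are available over the complex numbers; statements over
  \<open>Rodd n\<close> are translated into this setting.\<close>

definition cscale :: "complex \<Rightarrow> mpoly \<Rightarrow> mpoly" where
  "cscale c p = const_mp c * p"

interpretation cvs: vector_space cscale
  by standard (simp_all add: cscale_def algebra_simps const_mp_add const_mp_mult)

lemma span_const_mult: "p \<in> cvs.span S \<Longrightarrow> const_mp c * p \<in> cvs.span S"
  using cvs.span_scale [of p S c] by (simp add: cscale_def)

lemma span_induct_const [consumes 1, case_names 0 step]:
  assumes "x \<in> cvs.span S" "h 0" "\<And>c x y. x \<in> S \<Longrightarrow> h y \<Longrightarrow> h (const_mp c * x + y)"
  shows "h x"
  using assms(1) by (induction rule: cvs.span_induct_alt) (simp_all add: assms(2,3) cscale_def)

lemma sum_single_lookup: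
  fixes p :: "'a \<Rightarrow>\<^sub>0 'b::comm_monoid_add"
  assumes "finite A" "Poly_Mapping.keys p \<subseteq> A"
  shows "(\<Sum>m\<in>A. Poly_Mapping.single m (Poly_Mapping.lookup p m)) = p"
proof (rule poly_mapping_eqI)
  fix k
  show "Poly_Mapping.lookup (\<Sum>m\<in>A. Poly_Mapping.single m (Poly_Mapping.lookup p m)) k = Poly_Mapping.lookup p k"
    using assms by (auto simp: lookup_sum lookup_single when_def in_keys_iff)
qed

lemma keys_sum_subset:
  assumes "\<And>x. x \<in> A \<Longrightarrow> Poly_Mapping.keys (f x) \<subseteq> B"
  shows "Poly_Mapping.keys (sum f A) \<subseteq> B"
  using assms
proof (induction A rule: infinite_finite_induct)
  case (insert x F)
  thus ?case using Poly_Mapping.keys_add [of "f x" "sum f F"] by auto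
qed auto

subsection \<open>The action of permutations\<close>

lemma lookup_perm_mono:
  assumes "\<sigma> permutes S"
  shows "Poly_Mapping.lookup (perm_mono \<sigma> m) i = Poly_Mapping.lookup m (inv_into UNIV \<sigma> i)"
proof -
  have "(\<sigma> j = i) = (j = inv_into UNIV \<sigma> i)" for j
    using assms by (metis permutes_inverses)
  thus ?thesis
    by (auto simp: perm_mono_def lookup_sum lookup_single when_def in_keys_iff)
qed

lemma perm_mono_add:
  assumes "\<sigma> permutes S"
  shows "perm_mono \<sigma> (m + m') = perm_mono \<sigma> m + perm_mono \<sigma> m'"
  by (rule poly_mapping_eqI) (simp add: lookup_perm_mono [OF assms] lookup_add)

lemma perm_mono_inv:
  assumes "\<sigma> permutes S"
  shows "perm_mono (inv_into UNIV \<sigma>) (perm_mono \<sigma> m) = m" "perm_mono \<sigma> (perm_mono (inv_into UNIV \<sigma>) m) = m"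
  by (rule poly_mapping_eqI; simp add: lookup_perm_mono [OF assms]
      lookup_perm_mono [OF permutes_inv [OF assms]] permutes_inv_inv [OF assms] permutes_inverses [OF assms])+

lemma bij_perm_mono:
  assumes "\<sigma> permutes S"
  shows "bij (perm_mono \<sigma>)"
  by (rule o_bij [of "perm_mono (inv_into UNIV \<sigma>)"]) (auto simp: perm_mono_inv [OF assms])

lemma keys_perm_mono:
  assumes "\<sigma> permutes S"
  shows "Poly_Mapping.keys (perm_mono \<sigma> m) = \<sigma> ` Poly_Mapping.keys m"
proof -
  have *: "i \<in> Poly_Mapping.keys (perm_mono \<sigma> m) \<longleftrightarrow> inv_into UNIV \<sigma> i \<in> Poly_Mapping.keys m" for i
    by (simp add: in_keys_iff lookup_perm_mono [OF assms])
  show ?thesis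
  proof (intro equalityI subsetI)
    fix i assume "i \<in> Poly_Mapping.keys (perm_mono \<sigma> m)"
    thus "i \<in> \<sigma> ` Poly_Mapping.keys m"
      using permutes_inverses(1) [OF assms, of i] by (intro image_eqI [of _ _ "inv_into UNIV \<sigma> i"]) (simp_all add: *)
  qed (auto simp: * permutes_inverses [OF assms])
qed

lemma keys_perm_mono_subset:
  assumes "\<sigma> permutes S" "Poly_Mapping.keys m \<subseteq> S"
  shows "Poly_Mapping.keys (perm_mono \<sigma> m) \<subseteq> S"
  using assms keys_perm_mono permutes_image by (metis image_mono)

lemma mdeg_perm_mono:
  assumes "\<sigma> permutes S"
  shows "mdeg (perm_mono \<sigma> m) = mdeg m"
proof -
  have "inj_on \<sigma> (Poly_Mapping.keys m)"
    using assms permutes_inj inj_on_subset by blast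
  thus ?thesis
    by (simp add: mdeg_def keys_perm_mono [OF assms] sum.reindex lookup_perm_mono [OF assms] permutes_inverses [OF assms])
qed

lemma mdeg_add: "mdeg (m + m') = mdeg m + mdeg m'"
proof -
  have *: "mdeg u = (\<Sum>i\<in>A. Poly_Mapping.lookup u i)" if "finite A" "Poly_Mapping.keys u \<subseteq> A" for A u
    unfolding mdeg_def using that by (intro sum.mono_neutral_left) (auto simp: in_keys_iff)
  let ?A = "Poly_Mapping.keys m \<union> Poly_Mapping.keys m'"
  show ?thesis
    using keys_add [of m m'] by (simp add: *[of ?A] lookup_add sum.distrib)
qed

lemma mdeg_0 [simp]: "mdeg 0 = 0"
  and mdeg_single [simp]: "mdeg (Poly_Mapping.single i k) = k"
  by (simp_all add: mdeg_def)

lemma mdeg_eq_sum: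
  assumes "Poly_Mapping.keys u \<subseteq> {..<n}"
  shows "mdeg u = (\<Sum>i<n. Poly_Mapping.lookup u i)"
  unfolding mdeg_def using assms by (intro sum.mono_neutral_left) (auto simp: in_keys_iff)

subsection \<open>Symmetric polynomials\<close>

text \<open>\<open>perm_mono \<sigma>\<close> is an additive bijection of the monomials, so it
  reindexes both summations in the convolution over the splittings m = l + r.\<close>

lemma Rn_mult:
  assumes "p \<in> Rn n" "q \<in> Rn n"
  shows "p * q \<in> Rn n"
proof -
  have "Poly_Mapping.keys m \<subseteq> {..<n}" if "m \<in> Poly_Mapping.keys (p * q)" for m
  proof -
    from that obtain a b where ab: "m = a + b" "a \<in> Poly_Mapping.keys p" "b \<in> Poly_Mapping.keys q"
      using keys_mult [of p q] by auto
    thus ?thesis using assms keys_add [of a b] by (fastforce simp: Rn_def)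
  qed
  moreover have "Poly_Mapping.lookup (p * q) (perm_mono \<sigma> m) = Poly_Mapping.lookup (p * q) m"
    if \<sigma>: "\<sigma> permutes {..<n}" for \<sigma> m
  proof -
    let ?\<pi> = "perm_mono \<sigma>"
    note bij = bij_perm_mono [OF \<sigma>]
    have inj: "?\<pi> x = ?\<pi> y \<longleftrightarrow> x = y" for x y
      using bij by (auto simp: bij_def inj_def)
    have inner: "Sum_any (\<lambda>r. Poly_Mapping.lookup q r when ?\<pi> m = ?\<pi> l + r)
        = Sum_any (\<lambda>r. Poly_Mapping.lookup q r when m = l + r)" for l
      using assms(2) \<sigma>
      by (intro Sum_any.reindex_cong [of ?\<pi>])
        (simp_all add: bij fun_eq_iff Rn_def perm_mono_add [OF \<sigma>, symmetric] inj bij_is_inj)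
    show ?thesis unfolding lookup_mult
      using assms(1) \<sigma>
      by (intro Sum_any.reindex_cong [of ?\<pi>]) (simp_all add: bij bij_is_inj fun_eq_iff Rn_def inner)
  qed
  ultimately show ?thesis by (auto simp: Rn_def)
qed

text \<open>Covers the unit, the \<open>hcomp\<close> and the orbit sums of the dimension count by a
  single symmetry criterion: stability of the set of monomials.\<close>

definition monomial_sum :: "(nat \<Rightarrow>\<^sub>0 nat) set \<Rightarrow> mpoly" where
  "monomial_sum A = (\<Sum>u\<in>A. Poly_Mapping.single u 1)"

lemma lookup_monomial_sum:
  "finite A \<Longrightarrow> Poly_Mapping.lookup (monomial_sum A) u = (if u \<in> A then 1 else 0)"
  by (simp add: monomial_sum_def lookup_sum lookup_single when_def)

lemma monomial_sum_in_Rn: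
  assumes "finite A" "\<And>u. u \<in> A \<Longrightarrow> Poly_Mapping.keys u \<subseteq> {..<n}"
    and "\<And>u \<sigma>. u \<in> A \<Longrightarrow> \<sigma> permutes {..<n} \<Longrightarrow> perm_mono \<sigma> u \<in> A"
  shows "monomial_sum A \<in> Rn n"
proof -
  have "perm_mono \<sigma> u \<in> A \<longleftrightarrow> u \<in> A" if "\<sigma> permutes {..<n}" for \<sigma> u
    using assms(3) that perm_mono_inv [OF that] permutes_inv by metis
  moreover have "Poly_Mapping.keys (monomial_sum A) \<subseteq> A"
    using assms(1) by (auto simp: in_keys_iff lookup_monomial_sum split: if_splits)
  ultimately show ?thesis using assms(1) assms(2) [THEN subsetD]
    unfolding Rn_def by (auto simp: lookup_monomial_sum)
qed

lemma lookup_le_mdeg: "Poly_Mapping.lookup u i \<le> mdeg u"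
  unfolding mdeg_def by (cases "i \<in> Poly_Mapping.keys u") (auto intro: member_le_sum simp: in_keys_iff)

lemma finite_monomials: "finite {u. Poly_Mapping.keys u \<subseteq> {..<n} \<and> mdeg u = k}"
proof -
  let ?F = "{f. \<forall>i. (i \<in> {..<n} \<longrightarrow> f i \<in> {..k}) \<and> (i \<notin> {..<n} \<longrightarrow> f i = (0::nat))}"
  have "inj_on Poly_Mapping.lookup {u. Poly_Mapping.keys u \<subseteq> {..<n} \<and> mdeg u = k}"
    by (rule inj_onI, rule poly_mapping_eqI) simp
  moreover have "Poly_Mapping.lookup ` {u. Poly_Mapping.keys u \<subseteq> {..<n} \<and> mdeg u = k} \<subseteq> ?F"
  proof (rule image_subsetI)
    fix u :: "nat \<Rightarrow>\<^sub>0 nat"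
    assume "u \<in> {u. Poly_Mapping.keys u \<subseteq> {..<n} \<and> mdeg u = k}"
    thus "Poly_Mapping.lookup u \<in> ?F"
      using lookup_le_mdeg [of u] by (auto simp: in_keys_iff subset_iff)
  qed
  moreover have "finite ?F"
    by (rule finite_set_of_finite_funs) auto
  ultimately show ?thesis by (rule inj_on_finite)
qed

lemma hcomp_in_Rn: "hcomp n k \<in> Rn n"
proof -
  have "hcomp n k = monomial_sum {u. Poly_Mapping.keys u \<subseteq> {..<n} \<and> mdeg u = k}"
    by (simp add: hcomp_def monomial_sum_def)
  thus ?thesis
    using monomial_sum_in_Rn [OF finite_monomials] keys_perm_mono_subset mdeg_perm_mono by auto
qed

lemma one_in_Rn: "1 \<in> Rn n"
proof -
  have "(1 :: mpoly) = monomial_sum {0}" by (simp add: monomial_sum_def)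
  thus ?thesis
    using monomial_sum_in_Rn [of "{0}" n] by (simp add: perm_mono_def)
qed

lemma hbasis_in_Rn: "hbasis n M \<in> Rn n"
  by (induction M) (simp_all add: hbasis_def one_in_Rn Rn_mult hcomp_in_Rn)

subsection \<open>Homogeneous components\<close>

definition hom_comp :: "nat \<Rightarrow> mpoly \<Rightarrow> mpoly" where
  "hom_comp d p = (\<Sum>m\<in>{m\<in>Poly_Mapping.keys p. mdeg m = d}. Poly_Mapping.single m (Poly_Mapping.lookup p m))"

definition homogeneous :: "nat \<Rightarrow> mpoly \<Rightarrow> bool" where
  "homogeneous d p \<longleftrightarrow> (\<forall>m\<in>Poly_Mapping.keys p. mdeg m = d)"

lemma lookup_hom_comp:
  "Poly_Mapping.lookup (hom_comp d p) m = (if mdeg m = d then Poly_Mapping.lookup p m else 0)"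
  by (auto simp: hom_comp_def lookup_sum lookup_single when_def in_keys_iff)

lemma hom_comp_0 [simp]: "hom_comp d 0 = 0"
  and hom_comp_add: "hom_comp d (p + q) = hom_comp d p + hom_comp d q"
  and hom_comp_const_mult: "hom_comp d (const_mp c * p) = const_mp c * hom_comp d p"
  by (rule poly_mapping_eqI; simp add: lookup_hom_comp lookup_add)+

lemma hom_comp_sum: "hom_comp d (sum f A) = (\<Sum>x\<in>A. hom_comp d (f x))"
  by (induction A rule: infinite_finite_induct) (simp_all add: hom_comp_add)

lemma hom_comp_homogeneous:
  "homogeneous k p \<Longrightarrow> hom_comp d p = (if d = k then p else 0)"
  by (rule poly_mapping_eqI) (auto simp: lookup_hom_comp homogeneous_def in_keys_iff)

lemma homogeneous_hom_comp: "homogeneous d (hom_comp d p)"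
  by (auto simp: homogeneous_def in_keys_iff lookup_hom_comp split: if_splits)

lemma homogeneous_mult:
  assumes "homogeneous a p" "homogeneous b q"
  shows "homogeneous (a + b) (p * q)"
  using assms keys_mult [of p q] by (fastforce simp: homogeneous_def mdeg_add)

lemma homogeneous_one: "homogeneous 0 1"
  by (simp add: homogeneous_def)

lemma homogeneous_sum: "(\<And>x. x \<in> A \<Longrightarrow> homogeneous d (f x)) \<Longrightarrow> homogeneous d (sum f A)"
  using keys_sum_subset [of A f "{m. mdeg m = d}"] by (auto simp: homogeneous_def)

lemma sum_hom_comp: "\<exists>N. p = (\<Sum>d<N. hom_comp d p)"
proof -
  obtain N where N: "\<And>m. m \<in> Poly_Mapping.keys p \<Longrightarrow> mdeg m < N"
    using finite_nat_set_iff_bounded [of "mdeg ` Poly_Mapping.keys p"] by auto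
  have "p = (\<Sum>d<N. hom_comp d p)"
    by (rule poly_mapping_eqI) (use N in \<open>auto simp: lookup_sum lookup_hom_comp in_keys_iff\<close>)
  thus ?thesis ..
qed

text \<open>For a factor of positive degree the shift d - k is what makes the degree induction of
  the graded Nakayama lemma descend.\<close>

lemma hom_comp_mult:
  assumes "homogeneous k p"
  shows "hom_comp d (p * q) = (if k \<le> d then p * hom_comp (d - k) q else 0)"
proof -
  obtain N where N: "q = (\<Sum>e<N. hom_comp e q)" by (rule exE [OF sum_hom_comp])
  have "hom_comp d (p * hom_comp e q) = (if k \<le> d then p * hom_comp (d - k) (hom_comp e q) else 0)" for e
    using hom_comp_homogeneous [OF homogeneous_mult [OF assms homogeneous_hom_comp], of d e q]
      hom_comp_homogeneous [OF homogeneous_hom_comp, of "d - k" e q] by auto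
  hence "hom_comp d (p * (\<Sum>e<N. hom_comp e q)) = (if k \<le> d then p * hom_comp (d - k) (\<Sum>e<N. hom_comp e q) else 0)"
    by (simp add: sum_distrib_left hom_comp_sum)
  thus ?thesis by (simp only: N [symmetric])
qed

lemma var_power: "var i ^ k = Poly_Mapping.single (Poly_Mapping.single i k) 1"
  by (induction k) (simp_all add: var_def mult_single single_add [symmetric])

lemma homogeneous_psum: "homogeneous k (psum n k)"
  unfolding psum_def by (intro homogeneous_sum) (auto simp: homogeneous_def var_power)

lemma homogeneous_hcomp: "homogeneous k (hcomp n k)"
  unfolding hcomp_def by (intro homogeneous_sum) (auto simp: homogeneous_def)

lemma homogeneous_hbasis: "homogeneous (2 * \<Sum>\<^sub># M) (hbasis n M)"
proof (induction M)
  case empty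
  thus ?case by (simp add: hbasis_def homogeneous_one)
next
  case (add x M)
  thus ?case
    using homogeneous_mult [OF homogeneous_hcomp [of "2 * x"]] by (simp add: hbasis_def)
qed

subsection \<open>Symmetric polynomials are generated by power sums\<close>

text \<open>A working copy of the symmetric polynomials: once \<open>Rn n\<close> is known to lie
  inside, statements about them become inductions over power sum generators.\<close>

inductive_set psum_algebra :: "nat \<Rightarrow> mpoly set" for n where
  const: "const_mp c \<in> psum_algebra n"
| gen: "psum n k \<in> psum_algebra n"
| add: "p \<in> psum_algebra n \<Longrightarrow> q \<in> psum_algebra n \<Longrightarrow> p + q \<in> psum_algebra n"
| mult: "p \<in> psum_algebra n \<Longrightarrow> q \<in> psum_algebra n \<Longrightarrow> p * q \<in> psum_algebra n"

lemma psum_algebra_0: "0 \<in> psum_algebra n"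
  and psum_algebra_1: "1 \<in> psum_algebra n"
  using psum_algebra.const [of 0 n] psum_algebra.const [of 1 n] by simp_all

lemma psum_algebra_uminus: "p \<in> psum_algebra n \<Longrightarrow> - p \<in> psum_algebra n"
  using psum_algebra.mult [OF psum_algebra.const [of "-1"], of p n] by (simp add: const_mp_uminus)

lemma psum_algebra_diff: "p \<in> psum_algebra n \<Longrightarrow> q \<in> psum_algebra n \<Longrightarrow> p - q \<in> psum_algebra n"
  using psum_algebra.add [OF _ psum_algebra_uminus, of p n q] by simp

lemma psum_algebra_sum: "(\<And>x. x \<in> A \<Longrightarrow> f x \<in> psum_algebra n) \<Longrightarrow> sum f A \<in> psum_algebra n"
  by (induction A rule: infinite_finite_induct) (simp_all add: psum_algebra_0 psum_algebra.add)

text \<open>Characteristic zero enters here: Newton's identities leave a factor k, averaging over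
  permutations a factor n!.\<close>

lemma psum_algebra_cancel_nat:
  assumes "of_nat k * p \<in> psum_algebra n" "k > 0"
  shows "p \<in> psum_algebra n"
proof -
  have "const_mp (inverse (of_nat k)) * (const_mp (of_nat k) * p) \<in> psum_algebra n"
    using assms(1) by (simp only: const_mp_of_nat psum_algebra.mult psum_algebra.const)
  moreover have "(of_nat k :: complex) \<noteq> 0" using assms(2) by simp
  ultimately show ?thesis using const_mp_inverse_mult [of "of_nat k" p] by metis
qed

section \<open>Augmented monomial symmetric polynomials\<close>

definition index_lists :: "nat \<Rightarrow> nat \<Rightarrow> nat list set" where
  "index_lists n r = {js. length js = r \<and> distinct js \<and> set js \<subseteq> {..<n}}"

definition index_mono :: "nat list \<Rightarrow> nat list \<Rightarrow> mpoly" where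
  "index_mono us js = (\<Prod>k<length us. var (js ! k) ^ (us ! k))"

text \<open>The exponents \<open>us\<close> are placed on pairwise distinct variables in all ordered
  ways. A zero exponent also occupies a variable, and equal exponents produce the same monomial
  repeatedly; these multiplicities keep the recursion free of case distinctions.\<close>

definition aug_mono :: "nat \<Rightarrow> nat list \<Rightarrow> mpoly" where
  "aug_mono n us = (\<Sum>js\<in>index_lists n (length us). index_mono us js)"

lemma finite_index_lists [simp]: "finite (index_lists n r)"
  by (rule finite_subset [OF _ finite_lists_length_eq [of "{..<n}" r]]) (auto simp: index_lists_def)

lemma index_lists_Suc:
  "index_lists n (Suc r) = (\<lambda>(js, j). j # js) ` (SIGMA js : index_lists n r. {..<n} - set js)"
  by (force simp: index_lists_def length_Suc_conv)

lemma index_mono_Cons: "index_mono (a # us) (j # js) = var j ^ a * index_mono us js"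
  by (simp add: index_mono_def prod.lessThan_Suc_shift del: prod.lessThan_Suc)

lemma index_mono_update:
  assumes "k < length us"
  shows "index_mono (us[k := us ! k + a]) js = var (js ! k) ^ a * index_mono us js"
proof -
  have "(\<Prod>i\<in>{..<length us} - {k}. var (js ! i) ^ (us[k := us ! k + a] ! i))
      = (\<Prod>i\<in>{..<length us} - {k}. var (js ! i) ^ (us ! i))"
    by (intro prod.cong) auto
  thus ?thesis using assms
    by (simp add: index_mono_def prod.remove [of "{..<length us}" k] power_add mult_ac)
qed

text \<open>In the product with \<open>psum n a\<close> the new variable either is fresh, or it is
  the one already carrying the k-th exponent, which then grows by \<open>a\<close>.\<close>

lemma aug_mono_Cons:
  "aug_mono n (a # us) = psum n a * aug_mono n us - (\<Sum>k<length us. aug_mono n (us[k := us ! k + a]))"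
proof -
  let ?D = "index_lists n (length us)"
  have "aug_mono n (a # us) = (\<Sum>(js, j)\<in>(SIGMA js : ?D. {..<n} - set js). var j ^ a * index_mono us js)"
    unfolding aug_mono_def list.size add_Suc_right add_0_right index_lists_Suc
    by (subst sum.reindex) (auto simp: inj_on_def index_mono_Cons intro!: sum.cong)
  also have "\<dots> = (\<Sum>js\<in>?D. \<Sum>j\<in>{..<n} - set js. var j ^ a * index_mono us js)"
    by (rule sum.Sigma [symmetric]) auto
  also have "\<dots> = (\<Sum>js\<in>?D. (\<Sum>j<n. var j ^ a * index_mono us js) - (\<Sum>j\<in>set js. var j ^ a * index_mono us js))"
    by (intro sum.cong refl sum_diff) (auto simp: index_lists_def)
  also have "\<dots> = (\<Sum>js\<in>?D. psum n a * index_mono us js - (\<Sum>k<length us. index_mono (us[k := us ! k + a]) js))"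
  proof (intro sum.cong refl)
    fix js assume js: "js \<in> ?D"
    have "(\<Sum>j<n. var j ^ a * index_mono us js) = psum n a * index_mono us js"
      by (simp add: psum_def sum_distrib_right)
    moreover have "set js = (!) js ` {..<length us}"
      using js by (auto simp: index_lists_def set_conv_nth)
    moreover have "inj_on ((!) js) {..<length us}"
      using js by (auto simp: index_lists_def inj_on_def nth_eq_iff_index_eq)
    ultimately show "(\<Sum>j<n. var j ^ a * index_mono us js) - (\<Sum>j\<in>set js. var j ^ a * index_mono us js)
        = psum n a * index_mono us js - (\<Sum>k<length us. index_mono (us[k := us ! k + a]) js)"
      by (simp add: sum.reindex index_mono_update)
  qed
  also have "\<dots> = psum n a * aug_mono n us - (\<Sum>js\<in>?D. \<Sum>k<length us. index_mono (us[k := us ! k + a]) js)"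
    by (simp add: sum_subtractf aug_mono_def sum_distrib_left)
  also have "(\<Sum>js\<in>?D. \<Sum>k<length us. index_mono (us[k := us ! k + a]) js)
      = (\<Sum>k<length us. aug_mono n (us[k := us ! k + a]))"
    by (subst sum.swap) (simp add: aug_mono_def)
  finally show ?thesis .
qed

text \<open>The corrections in \<open>aug_mono_Cons\<close> have larger exponents but one entry
  fewer than \<open>a # us\<close>, so the induction runs on the length.\<close>

lemma aug_mono_in_psum_algebra: "aug_mono n us \<in> psum_algebra n"
proof (induction "length us" arbitrary: us)
  case 0
  have "index_lists n 0 = {[]}" by (auto simp: index_lists_def)
  thus ?case using 0 by (simp add: aug_mono_def index_mono_def psum_algebra_1)
next
  case (Suc r)
  then obtain a us' where us: "us = a # us'" "length us' = r" by (metis length_Suc_conv)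
  show ?case unfolding us(1) aug_mono_Cons
    using Suc.hyps(1) us(2)
    by (intro psum_algebra_diff psum_algebra.mult psum_algebra.gen psum_algebra_sum) simp_all
qed

lemma single_eq_prod_var:
  assumes "Poly_Mapping.keys u \<subseteq> {..<n}"
  shows "Poly_Mapping.single u 1 = (\<Prod>i<n. var i ^ Poly_Mapping.lookup u i)"
proof -
  have *: "(\<Prod>i\<in>A. Poly_Mapping.single (v i) 1) = (Poly_Mapping.single (\<Sum>i\<in>A. v i) 1 :: mpoly)"
    if "finite A" for A :: "nat set" and v :: "nat \<Rightarrow> nat \<Rightarrow>\<^sub>0 nat"
    using that by (induction A) (simp_all add: mult_single)
  show ?thesis
    using sum_single_lookup [OF finite_lessThan assms] by (simp add: var_power *)
qed

text \<open>A list of n distinct indices below n is a permutation written out. Each monomial in the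
  orbit of \<open>u\<close> is thus counted as often as the stabilizer of \<open>u\<close> has
  elements.\<close>

lemma aug_mono_perm:
  assumes u: "Poly_Mapping.keys u \<subseteq> {..<n}"
  shows "aug_mono n (map (Poly_Mapping.lookup u) [0..<n])
    = (\<Sum>\<sigma> | \<sigma> permutes {..<n}. Poly_Mapping.single (perm_mono \<sigma> u) 1)"
proof -
  let ?f = "\<lambda>\<sigma>. map \<sigma> [0..<n]"
  have "bij_betw ?f {\<sigma>. \<sigma> permutes {..<n}} (index_lists n n)"
  proof (rule bij_betw_imageI)
    show "inj_on ?f {\<sigma>. \<sigma> permutes {..<n}}"
    proof (rule inj_onI, rule ext)
      fix \<sigma> \<tau> i assume *: "\<sigma> \<in> {\<sigma>. \<sigma> permutes {..<n}}" "\<tau> \<in> {\<sigma>. \<sigma> permutes {..<n}}" "?f \<sigma> = ?f \<tau>"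
      show "\<sigma> i = \<tau> i"
      proof (cases "i < n")
        case True
        thus ?thesis using * by (auto simp: list_eq_iff_nth_eq)
      next
        case False
        thus ?thesis using * by (auto simp: permutes_def)
      qed
    qed
    show "?f ` {\<sigma>. \<sigma> permutes {..<n}} = index_lists n n"
    proof (intro equalityI subsetI)
      fix js assume "js \<in> ?f ` {\<sigma>. \<sigma> permutes {..<n}}"
      then obtain \<sigma> where \<sigma>: "\<sigma> permutes {..<n}" "js = ?f \<sigma>" by blast
      have "\<sigma> ` {..<n} = {..<n}" using \<sigma>(1) by (rule permutes_image)
      thus "js \<in> index_lists n n"
        using permutes_inj_on [OF \<sigma>(1)] by (simp add: \<sigma>(2) index_lists_def distinct_map atLeast0LessThan)
    next
      fix js assume js: "js \<in> index_lists n n"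
      define \<sigma> where "\<sigma> i = (if i < n then js ! i else i)" for i
      have inj: "inj_on \<sigma> {..<n}"
        using js by (auto simp: index_lists_def inj_on_def \<sigma>_def nth_eq_iff_index_eq)
      have "\<sigma> ` {..<n} \<subseteq> {..<n}"
        using js by (auto simp: index_lists_def \<sigma>_def dest: nth_mem)
      hence "\<sigma> ` {..<n} = {..<n}"
        using inj by (simp add: endo_inj_surj)
      hence "\<sigma> permutes {..<n}"
        using inj by (intro bij_imp_permutes) (auto simp: bij_betw_def \<sigma>_def)
      moreover have "js = ?f \<sigma>"
        using js by (auto simp: list_eq_iff_nth_eq index_lists_def \<sigma>_def)
      ultimately show "js \<in> ?f ` {\<sigma>. \<sigma> permutes {..<n}}" by blast
    qed
  qed
  moreover have "index_mono (map (Poly_Mapping.lookup u) [0..<n]) (?f \<sigma>) = Poly_Mapping.single (perm_mono \<sigma> u) 1"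
    if "\<sigma> permutes {..<n}" for \<sigma>
  proof -
    have "Poly_Mapping.single (perm_mono \<sigma> u) 1 = (\<Prod>i<n. var i ^ Poly_Mapping.lookup (perm_mono \<sigma> u) i)"
      using single_eq_prod_var keys_perm_mono_subset [OF that u] by blast
    also have "\<dots> = (\<Prod>i<n. var (\<sigma> i) ^ Poly_Mapping.lookup (perm_mono \<sigma> u) (\<sigma> i))"
      by (rule prod.permute [OF that, unfolded comp_def])
    finally show ?thesis
      by (simp add: index_mono_def lookup_perm_mono [OF that] permutes_inverses [OF that])
  qed
  ultimately show ?thesis
    unfolding aug_mono_def by (simp add: sum.reindex_bij_betw [symmetric])
qed

text \<open>Averaging over all permutations: each one maps \<open>p\<close> to itself, so the total
  is n! times \<open>p\<close>, while for a fixed monomial the sum is an \<open>aug_mono\<close>. No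
  representatives of orbits have to be chosen.\<close>

lemma Rn_subset_psum_algebra: "Rn n \<subseteq> psum_algebra n"
proof
  fix p assume p: "p \<in> Rn n"
  let ?\<Sigma> = "{\<sigma>. \<sigma> permutes {..<n}}" and ?K = "Poly_Mapping.keys p"
  have "(\<Sum>u\<in>?K. const_mp (Poly_Mapping.lookup p u) * aug_mono n (map (Poly_Mapping.lookup u) [0..<n])) =
      (\<Sum>u\<in>?K. \<Sum>\<sigma>\<in>?\<Sigma>. Poly_Mapping.single (perm_mono \<sigma> u) (Poly_Mapping.lookup p u))"
    using p by (intro sum.cong refl)
      (simp add: aug_mono_perm Rn_def sum_distrib_left const_mp_def mult_single)
  also have "\<dots> = (\<Sum>\<sigma>\<in>?\<Sigma>. \<Sum>u\<in>?K. Poly_Mapping.single (perm_mono \<sigma> u) (Poly_Mapping.lookup p u))"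
    by (rule sum.swap)
  also have "\<dots> = (\<Sum>\<sigma>\<in>?\<Sigma>. p)"
  proof (intro sum.cong refl)
    fix \<sigma> assume "\<sigma> \<in> ?\<Sigma>"
    hence \<sigma>: "\<sigma> permutes {..<n}" by simp
    hence inv: "Poly_Mapping.lookup p (perm_mono \<sigma> u) = Poly_Mapping.lookup p u" for u
      using p by (simp add: Rn_def)
    have inj: "inj_on (perm_mono \<sigma>) ?K"
      using bij_perm_mono [OF \<sigma>] by (auto simp: bij_def intro: inj_on_subset)
    moreover have "perm_mono \<sigma> ` ?K \<subseteq> ?K" using inv by (auto simp: in_keys_iff)
    ultimately have "perm_mono \<sigma> ` ?K = ?K" by (simp add: endo_inj_surj)
    hence "(\<Sum>u\<in>?K. Poly_Mapping.single (perm_mono \<sigma> u) (Poly_Mapping.lookup p (perm_mono \<sigma> u)))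
        = (\<Sum>u\<in>?K. Poly_Mapping.single u (Poly_Mapping.lookup p u))"
      using sum.reindex [OF inj, of "\<lambda>u. Poly_Mapping.single u (Poly_Mapping.lookup p u)"] by simp
    thus "(\<Sum>u\<in>?K. Poly_Mapping.single (perm_mono \<sigma> u) (Poly_Mapping.lookup p u)) = p"
      by (simp add: inv sum_single_lookup)
  qed
  also have "\<dots> = of_nat (fact n) * p"
    by (simp add: card_permutations)
  finally have "of_nat (fact n) * p =
      (\<Sum>u\<in>?K. const_mp (Poly_Mapping.lookup p u) * aug_mono n (map (Poly_Mapping.lookup u) [0..<n]))" ..
  also have "\<dots> \<in> psum_algebra n"
    by (intro psum_algebra_sum psum_algebra.mult psum_algebra.const aug_mono_in_psum_algebra)
  finally show "p \<in> psum_algebra n" by (rule psum_algebra_cancel_nat) simp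
qed

subsection \<open>Newton's identities\<close>

lemma hcomp_0 [simp]: "hcomp n 0 = 1"
proof -
  have "{m. Poly_Mapping.keys m \<subseteq> {..<n} \<and> mdeg m = 0} = {0}"
  proof (intro equalityI subsetI)
    fix m assume "m \<in> {m. Poly_Mapping.keys m \<subseteq> {..<n} \<and> mdeg m = 0}"
    hence "Poly_Mapping.lookup m i = 0" for i using lookup_le_mdeg [of m i] by simp
    thus "m \<in> {0}" by (simp add: poly_mapping_eqI)
  qed auto
  thus ?thesis by (simp add: hcomp_def)
qed

lemma hcomp_no_vars: "k > 0 \<Longrightarrow> hcomp 0 k = 0"
  by (simp add: hcomp_def)

lemma hcomp_Suc_Suc: "hcomp (Suc n) (Suc k) = hcomp n (Suc k) + var n * hcomp (Suc n) k"
proof -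
  let ?S = "\<lambda>n k. {m. Poly_Mapping.keys m \<subseteq> {..<n} \<and> mdeg m = k}"
  let ?e = "Poly_Mapping.single n (1::nat)"
  have eq: "?S (Suc n) (Suc k) = ?S n (Suc k) \<union> (+) ?e ` ?S (Suc n) k" (is "?L = ?A \<union> ?B")
  proof (intro equalityI subsetI)
    fix m assume m: "m \<in> ?L"
    show "m \<in> ?A \<union> ?B"
    proof (cases "n \<in> Poly_Mapping.keys m")
      case True
      hence eq: "m = ?e + (m - ?e)"
        by (intro poly_mapping_eqI) (auto simp: lookup_add lookup_minus lookup_single when_def in_keys_iff)
      have "Poly_Mapping.keys (m - ?e) \<subseteq> Poly_Mapping.keys m"
        by (auto simp: in_keys_iff lookup_minus)
      moreover have "mdeg m = Suc (mdeg (m - ?e))"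
        using arg_cong [OF eq, of mdeg] by (simp add: mdeg_add)
      ultimately have "m - ?e \<in> ?S (Suc n) k" using m by auto
      thus ?thesis using eq by blast
    next
      case False
      thus ?thesis using m by (auto simp: less_Suc_eq)
    qed
  next
    fix m assume "m \<in> ?A \<union> ?B"
    thus "m \<in> ?L"
    proof
      assume "m \<in> ?B"
      then obtain u where u: "u \<in> ?S (Suc n) k" "m = ?e + u" by blast
      thus ?thesis using keys_add [of ?e u] by (auto simp: mdeg_add)
    qed (auto simp: less_Suc_eq)
  qed
  have "?A \<inter> ?B = {}"
  proof -
    have "n \<in> Poly_Mapping.keys (?e + u)" for u by (simp add: in_keys_iff lookup_add)
    thus ?thesis by fastforce
  qed
  hence "hcomp (Suc n) (Suc k) = hcomp n (Suc k) + (\<Sum>m\<in>?B. Poly_Mapping.single m 1)"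
    unfolding hcomp_def eq by (intro sum.union_disjoint finite_monomials finite_imageI) auto
  also have "(\<Sum>m\<in>?B. Poly_Mapping.single m 1) = var n * hcomp (Suc n) k"
    by (subst sum.reindex) (auto simp: hcomp_def var_def sum_distrib_left mult_single)
  finally show ?thesis .
qed

section \<open>Generating functions of h, e and p\<close>

definition h_fps :: "nat \<Rightarrow> mpoly fps" where
  "h_fps n = Abs_fps (hcomp n)"

definition e_fps :: "nat \<Rightarrow> mpoly fps" where
  "e_fps n = (\<Prod>i<n. 1 - fps_const (var i) * fps_X)"

text \<open>The constant term is 0 instead of \<open>psum n 0\<close>, so that the series is the sum
  of x_i t / (1 - x_i t), that is, t H'(t) / H(t).\<close>

definition p_fps :: "nat \<Rightarrow> mpoly fps" where
  "p_fps n = Abs_fps (\<lambda>k. if k = 0 then 0 else psum n k)"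

lemma fps_nth_mult_linear:
  fixes f :: "'a::comm_ring_1 fps"
  shows "fps_nth (f * (1 - fps_const a * fps_X)) k = fps_nth f k - (if k = 0 then 0 else a * fps_nth f (k - 1))"
proof -
  have "f * (1 - fps_const a * fps_X) = f - fps_const a * (fps_X * f)"
    by (simp add: right_diff_distrib mult_ac)
  thus ?thesis by simp
qed

lemma h_fps_Suc: "h_fps (Suc n) * (1 - fps_const (var n) * fps_X) = h_fps n"
proof (rule fps_ext)
  fix k
  show "fps_nth (h_fps (Suc n) * (1 - fps_const (var n) * fps_X)) k = fps_nth (h_fps n) k"
    by (cases k) (simp_all add: fps_nth_mult_linear h_fps_def hcomp_Suc_Suc)
qed

lemma h_fps_mult_e_fps: "h_fps n * e_fps n = 1"
proof (induction n)
  case 0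
  show ?case by (rule fps_ext) (simp add: e_fps_def h_fps_def hcomp_no_vars)
next
  case (Suc n)
  have "h_fps (Suc n) * e_fps (Suc n) = (h_fps (Suc n) * (1 - fps_const (var n) * fps_X)) * e_fps n"
    by (simp add: e_fps_def mult_ac)
  thus ?case by (simp only: h_fps_Suc Suc.IH)
qed

text \<open>One more variable x adds the geometric series x t / (1 - x t); the identity is stated
  with the denominator cleared.\<close>

lemma p_fps_Suc:
  "(1 - fps_const (var n) * fps_X) * p_fps (Suc n)
    = (1 - fps_const (var n) * fps_X) * p_fps n + fps_const (var n) * fps_X"
proof -
  define G :: "mpoly fps" where "G = Abs_fps (\<lambda>k. if k = 0 then 0 else var n ^ k)"
  have "p_fps (Suc n) = p_fps n + G"
    by (rule fps_ext) (simp add: p_fps_def psum_def G_def)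
  moreover have "(1 - fps_const (var n) * fps_X) * G = fps_const (var n) * fps_X"
  proof (rule fps_ext)
    fix k
    have "fps_nth ((1 - fps_const (var n) * fps_X) * G) k
        = fps_nth G k - (if k = 0 then 0 else var n * fps_nth G (k - 1))"
      by (subst mult.commute) (rule fps_nth_mult_linear)
    moreover have "k = 0 \<or> k = 1 \<or> (\<exists>j. k = Suc (Suc j))" by presburger
    ultimately show "fps_nth ((1 - fps_const (var n) * fps_X) * G) k = fps_nth (fps_const (var n) * fps_X) k"
      by (auto simp: G_def)
  qed
  ultimately show ?thesis by (simp add: distrib_left)
qed

text \<open>The logarithmic derivative of the product \<open>e_fps n\<close>, with denominators
  cleared; the induction adds one linear factor at a time by the product rule.\<close>

lemma e_fps_mult_p_fps: "e_fps n * p_fps n = - (fps_X * fps_deriv (e_fps n))"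
proof (induction n)
  case 0
  show ?case by (simp add: e_fps_def p_fps_def psum_def fps_ext)
next
  case (Suc n)
  let ?L = "1 - fps_const (var n) * fps_X"
  have E: "e_fps (Suc n) = e_fps n * ?L" by (simp add: e_fps_def)
  have "e_fps (Suc n) * p_fps (Suc n) = ?L * (e_fps n * p_fps n) + e_fps n * (fps_const (var n) * fps_X)"
    using arg_cong [OF p_fps_Suc, of "(*) (e_fps n)" n] by (simp add: E algebra_simps)
  also have "\<dots> = - (fps_X * fps_deriv (e_fps n * ?L))"
    by (simp add: Suc.IH algebra_simps)
  finally show ?case by (simp add: E)
qed

lemma X_mult_deriv_h_fps: "fps_X * fps_deriv (h_fps n) = p_fps n * h_fps n"
proof -
  have deriv: "fps_deriv (h_fps n) * e_fps n = - (h_fps n * fps_deriv (e_fps n))"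
    using arg_cong [OF h_fps_mult_e_fps, of fps_deriv n] by (simp add: add_eq_0_iff add.commute)
  \<comment> \<open>Inserting the factor H(t) E(-t) = 1 lets the derivative of H be traded for that
    of E.\<close>
  have "fps_X * fps_deriv (h_fps n) * (h_fps n * e_fps n) = fps_X * h_fps n * (fps_deriv (h_fps n) * e_fps n)"
    by (simp only: mult_ac)
  also have "\<dots> = h_fps n * h_fps n * - (fps_X * fps_deriv (e_fps n))"
    unfolding deriv by (simp only: mult_minus_right mult_ac)
  also have "\<dots> = (h_fps n * e_fps n) * (p_fps n * h_fps n)"
    by (simp only: e_fps_mult_p_fps [symmetric] mult_ac)
  finally show ?thesis by (simp add: h_fps_mult_e_fps)
qed

text \<open>The coefficients are the signed elementary symmetric polynomials \<open>(-1)\<^sup>k e\<^sub>k\<close>.\<close>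

definition e_coeff :: "nat \<Rightarrow> nat \<Rightarrow> mpoly" where
  "e_coeff n k = fps_nth (e_fps n) k"

lemma e_coeff_0 [simp]: "e_coeff n 0 = 1"
  by (induction n) (simp_all add: e_coeff_def e_fps_def)

text \<open>\<open>e_fps n\<close> is a polynomial of degree at most n in the series variable. This
  caps the recurrence for the even h at order \<open>n div 2\<close>.\<close>

lemma e_coeff_eq_0: "k > n \<Longrightarrow> e_coeff n k = 0"
proof (induction n arbitrary: k)
  case (Suc n)
  then obtain k' where "k = Suc k'" "k' > n" by (metis Suc_less_eq2)
  thus ?case using Suc.IH [of k] Suc.IH [of k']
    by (simp add: e_coeff_def e_fps_def fps_nth_mult_linear)
qed (simp add: e_coeff_def e_fps_def)

lemma sum_e_coeff_hcomp: "k > 0 \<Longrightarrow> (\<Sum>i\<le>k. e_coeff n i * hcomp n (k - i)) = 0"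
  using arg_cong [OF h_fps_mult_e_fps, of "\<lambda>f. fps_nth f k" n]
  by (subst (asm) mult.commute) (simp add: fps_mult_nth h_fps_def e_coeff_def atLeast0AtMost)

lemma newton_hcomp: "of_nat k * hcomp n k = (\<Sum>i\<in>{1..k}. psum n i * hcomp n (k - i))"
proof -
  have "fps_nth (fps_X * fps_deriv (h_fps n)) k = of_nat k * hcomp n k"
    by (cases k) (simp_all add: h_fps_def)
  moreover have "fps_nth (p_fps n * h_fps n) k = (\<Sum>i\<in>{1..k}. psum n i * hcomp n (k - i))"
    by (simp add: fps_mult_nth p_fps_def h_fps_def sum.atLeast_Suc_atMost [of 0])
  ultimately show ?thesis by (simp add: X_mult_deriv_h_fps)
qed

lemma newton_e_coeff: "of_nat k * e_coeff n k = - (\<Sum>i\<in>{1..k}. psum n i * e_coeff n (k - i))"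
proof -
  have "fps_nth (fps_X * fps_deriv (e_fps n)) k = of_nat k * e_coeff n k"
    by (cases k) (simp_all add: e_coeff_def)
  moreover have "fps_nth (p_fps n * e_fps n) k = (\<Sum>i\<in>{1..k}. psum n i * e_coeff n (k - i))"
    by (simp add: fps_mult_nth p_fps_def e_coeff_def sum.atLeast_Suc_atMost [of 0])
  moreover have "fps_X * fps_deriv (e_fps n) = - (p_fps n * e_fps n)"
    using e_fps_mult_p_fps [of n] by (simp add: mult.commute)
  ultimately show ?thesis by simp
qed

subsection \<open>The ideal generated by the odd power sums\<close>

text \<open>An ideal of \<open>psum_algebra n\<close> whose generators have index at most n, hence
  belong to \<open>Rodd n\<close>. The cofactor \<open>f\<close> sits in the generating rule so that
  induction meets single terms \<open>psum n k * f\<close>, the shape that the degree argument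
  handles.\<close>

inductive_set odd_ideal :: "nat \<Rightarrow> mpoly set" for n where
  zero: "0 \<in> odd_ideal n"
| gen: "odd k \<Longrightarrow> k \<le> n \<Longrightarrow> f \<in> psum_algebra n \<Longrightarrow> psum n k * f \<in> odd_ideal n"
| add: "p \<in> odd_ideal n \<Longrightarrow> q \<in> odd_ideal n \<Longrightarrow> p + q \<in> odd_ideal n"

lemma odd_ideal_mult: "p \<in> odd_ideal n \<Longrightarrow> f \<in> psum_algebra n \<Longrightarrow> p * f \<in> odd_ideal n"
proof (induction p rule: odd_ideal.induct)
  case (gen k g)
  thus ?case by (simp add: mult.assoc odd_ideal.gen psum_algebra.mult)
qed (simp_all add: odd_ideal.zero odd_ideal.add distrib_right)

lemma odd_ideal_mult_left: "p \<in> odd_ideal n \<Longrightarrow> f \<in> psum_algebra n \<Longrightarrow> f * p \<in> odd_ideal n"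
  by (subst mult.commute) (rule odd_ideal_mult)

lemma odd_ideal_uminus: "p \<in> odd_ideal n \<Longrightarrow> - p \<in> odd_ideal n"
  using odd_ideal_mult [OF _ psum_algebra_uminus [OF psum_algebra_1], of p n] by simp

lemma odd_ideal_sum: "(\<And>x. x \<in> A \<Longrightarrow> f x \<in> odd_ideal n) \<Longrightarrow> sum f A \<in> odd_ideal n"
  by (induction A rule: infinite_finite_induct) (simp_all add: odd_ideal.zero odd_ideal.add)

lemma odd_ideal_cancel_nat:
  assumes "of_nat k * p \<in> odd_ideal n" "k > 0"
  shows "p \<in> odd_ideal n"
proof -
  have "const_mp (inverse (of_nat k)) * (const_mp (of_nat k) * p) \<in> odd_ideal n"
    using assms(1) by (simp only: const_mp_of_nat odd_ideal_mult_left psum_algebra.const)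
  moreover have "(of_nat k :: complex) \<noteq> 0" using assms(2) by simp
  ultimately show ?thesis using const_mp_inverse_mult [of "of_nat k" p] by metis
qed

lemma hcomp_in_psum_algebra: "hcomp n k \<in> psum_algebra n"
  using hcomp_in_Rn Rn_subset_psum_algebra by blast

lemma hbasis_in_psum_algebra: "hbasis n M \<in> psum_algebra n"
  using hbasis_in_Rn Rn_subset_psum_algebra by blast

lemma e_coeff_in_psum_algebra: "e_coeff n k \<in> psum_algebra n"
proof (induction k rule: less_induct)
  case (less k)
  show ?case
  proof (cases "k = 0")
    case False
    have "of_nat k * e_coeff n k \<in> psum_algebra n"
      unfolding newton_e_coeff using less.IH
      by (intro psum_algebra_uminus psum_algebra_sum psum_algebra.mult psum_algebra.gen) auto
    thus ?thesis by (rule psum_algebra_cancel_nat) (use False in simp)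
  qed (simp add: psum_algebra_1)
qed

text \<open>For odd k, one of i and k - i is odd in each term of Newton's identity. Indices beyond n
  are settled by vanishing, so every odd power sum that occurs has index at most n.\<close>

lemma e_coeff_odd: "odd k \<Longrightarrow> e_coeff n k \<in> odd_ideal n"
proof (induction k rule: less_induct)
  case (less k)
  show ?case
  proof (cases "k > n")
    case False
    have "psum n i * e_coeff n (k - i) \<in> odd_ideal n" if i: "i \<in> {1..k}" for i
    proof (cases "odd i")
      case True
      thus ?thesis using i False by (intro odd_ideal.gen e_coeff_in_psum_algebra) auto
    next
      case False
      thus ?thesis using i less by (intro odd_ideal_mult_left psum_algebra.gen) auto
    qed
    hence "of_nat k * e_coeff n k \<in> odd_ideal n"
      unfolding newton_e_coeff by (intro odd_ideal_uminus odd_ideal_sum)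
    thus ?thesis by (rule odd_ideal_cancel_nat) (use less.prems odd_pos in simp)
  qed (simp add: e_coeff_eq_0 odd_ideal.zero)
qed

text \<open>In the convolution of e and h one of the two indices is odd. An odd index on e is
  covered for every size by \<open>e_coeff_odd\<close>, so power sums beyond n never appear.\<close>

lemma hcomp_odd: "odd k \<Longrightarrow> hcomp n k \<in> odd_ideal n"
proof (induction k rule: less_induct)
  case (less k)
  have "k > 0" using less.prems by (rule odd_pos)
  hence eq: "hcomp n k = - (\<Sum>i\<in>{1..k}. e_coeff n i * hcomp n (k - i))"
    using sum_e_coeff_hcomp [of k n]
    by (simp add: atMost_atLeast0 sum.atLeast_Suc_atMost [of 0] eq_neg_iff_add_eq_0)
  have "e_coeff n i * hcomp n (k - i) \<in> odd_ideal n" if "i \<in> {1..k}" for i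
  proof (cases "odd i")
    case True
    thus ?thesis by (intro odd_ideal_mult e_coeff_odd hcomp_in_psum_algebra)
  next
    case False
    thus ?thesis using that less by (intro odd_ideal_mult_left e_coeff_in_psum_algebra) auto
  qed
  hence "- (\<Sum>i\<in>{1..k}. e_coeff n i * hcomp n (k - i)) \<in> odd_ideal n"
    by (intro odd_ideal_uminus odd_ideal_sum)
  thus ?case by (simp only: eq)
qed

lemma psum_eq_hcomp:
  assumes "k > 0"
  shows "psum n k = of_nat k * hcomp n k - (\<Sum>i\<in>{1..<k}. psum n i * hcomp n (k - i))"
proof -
  have "{1..k} = insert k {1..<k}" using assms by auto
  thus ?thesis unfolding newton_hcomp by simp
qed

subsection \<open>Straightening products of complete homogeneous polynomials\<close>

text \<open>The Jacobi--Trudi determinants need \<open>h\<^sub>k = 0\<close> for negative \<open>k\<close>.\<close>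

definition h_even :: "nat \<Rightarrow> int \<Rightarrow> mpoly" where
  "h_even n z = (if z < 0 then 0 else hcomp n (2 * nat z))"

lemma h_even_in_psum_algebra: "h_even n z \<in> psum_algebra n"
  by (simp add: h_even_def psum_algebra_0 hcomp_in_psum_algebra)

lemma sum_atMost_double:
  fixes f :: "nat \<Rightarrow> 'a::comm_monoid_add"
  shows "(\<Sum>i\<le>2 * r. f i) = (\<Sum>k\<le>r. f (2 * k)) + (\<Sum>k<r. f (2 * k + 1))"
  by (induction r) (simp_all add: ac_simps)

text \<open>Modulo the ideal, \<open>e\<close> and \<open>h\<close> are supported in even degrees, so \<open>E(-t)H(t) = 1\<close> becomes a
  linear recurrence of order \<open>n div 2\<close> for the even \<open>h\<close>.\<close>

lemma h_even_recurrence: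
  assumes "r \<ge> 1"
  shows "(\<Sum>k\<le>n div 2. e_coeff n (2 * k) * h_even n (r - int k)) \<in> odd_ideal n"
proof -
  define R where "R = nat r"
  have R: "r = int R" "R \<ge> 1" using assms by (auto simp: R_def)
  let ?f = "\<lambda>k. e_coeff n (2 * k) * h_even n (r - int k)"
  \<comment> \<open>Two vanishing ranges move the upper limit from \<open>n div 2\<close> to
    \<open>R\<close>: \<open>e_coeff n (2 * k)\<close> is 0 above \<open>n div 2\<close>, and
    \<open>h_even\<close> is 0 at negative arguments.\<close>
  have "(\<Sum>k\<le>n div 2. ?f k) = (\<Sum>k\<le>n div 2 + R. ?f k)"
    by (intro sum.mono_neutral_left) (auto simp: e_coeff_eq_0)
  also have "\<dots> = (\<Sum>k\<le>R. ?f k)"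
    by (intro sum.mono_neutral_right) (auto simp: h_even_def R)
  also have "\<dots> = (\<Sum>k\<le>R. e_coeff n (2 * k) * hcomp n (2 * R - 2 * k))"
  proof (intro sum.cong refl)
    fix k assume "k \<in> {..R}"
    hence "r - int k \<ge> 0" "2 * nat (r - int k) = 2 * R - 2 * k" by (simp_all add: R)
    thus "?f k = e_coeff n (2 * k) * hcomp n (2 * R - 2 * k)" by (simp add: h_even_def)
  qed
  \<comment> \<open>The whole convolution in degree 2 R is 0, so its even-indexed half is minus the
    odd-indexed one, where every e has odd index.\<close>
  also have "\<dots> = - (\<Sum>k<R. e_coeff n (2 * k + 1) * hcomp n (2 * R - (2 * k + 1)))"
    using sum_e_coeff_hcomp [of "2 * R" n] R(2)
    by (simp add: sum_atMost_double eq_neg_iff_add_eq_0)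
  also have "\<dots> \<in> odd_ideal n"
    by (intro odd_ideal_uminus odd_ideal_sum odd_ideal_mult e_coeff_odd hcomp_in_psum_algebra) simp
  finally show ?thesis .
qed

lemma psum_algebra_prod: "(\<And>x. x \<in> A \<Longrightarrow> f x \<in> psum_algebra n) \<Longrightarrow> prod f A \<in> psum_algebra n"
  by (induction A rule: infinite_finite_induct) (simp_all add: psum_algebra_1 psum_algebra.mult)

lemma psum_algebra_power: "p \<in> psum_algebra n \<Longrightarrow> p ^ k \<in> psum_algebra n"
  by (induction k) (simp_all add: psum_algebra_1 psum_algebra.mult)

lemma signof_cases: "(signof \<sigma> :: mpoly) = 1 \<or> (signof \<sigma> :: mpoly) = - 1"
  by (simp add: sign_def)

lemma det_in_psum_algebra:
  assumes "B \<in> carrier_mat d d" "\<And>i j. i < d \<Longrightarrow> j < d \<Longrightarrow> B $$ (i, j) \<in> psum_algebra n"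
  shows "det B \<in> psum_algebra n"
proof -
  have "signof \<sigma> * (\<Prod>i = 0..<d. B $$ (i, \<sigma> i)) \<in> psum_algebra n" if "\<sigma> permutes {0..<d}" for \<sigma>
  proof (rule psum_algebra.mult)
    show "signof \<sigma> \<in> psum_algebra n"
      using signof_cases [of \<sigma>] psum_algebra_1 psum_algebra_uminus by metis
    show "(\<Prod>i = 0..<d. B $$ (i, \<sigma> i)) \<in> psum_algebra n"
      using permutes_in_image [OF that] by (intro psum_algebra_prod assms(2)) auto
  qed
  thus ?thesis unfolding det_def' [OF assms(1)] by (intro psum_algebra_sum) auto
qed

text \<open>Row i applied to the vector of e coefficients is the recurrence at r = l_i - i + m,
  which is at least 1 as l_i is positive and i is at most m. So \<open>A\<close> maps this vector
  into the ideal; the adjugate gives that det A times the vector is in the ideal, and one entry of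
  the vector is 1.\<close>

lemma det_h_even_in_odd_ideal:
  fixes n :: nat
  defines "m \<equiv> n div 2"
  assumes l: "\<And>i. i \<le> m \<Longrightarrow> l i \<ge> (1::nat)"
  shows "det (mat (Suc m) (Suc m) (\<lambda>(i, j). h_even n (int (l i) - int i + int j))) \<in> odd_ideal n"
proof -
  define A where "A = mat (Suc m) (Suc m) (\<lambda>(i, j). h_even n (int (l i) - int i + int j))"
  \<comment> \<open>The coefficients are reversed because arguments increase along a row of
    \<open>A\<close> but decrease in the recurrence. The last entry is
    \<open>e_coeff n 0 = 1\<close>.\<close>
  define v where "v = vec (Suc m) (\<lambda>j. e_coeff n (2 * (m - j)))"
  have A: "A \<in> carrier_mat (Suc m) (Suc m)" by (simp add: A_def)
  have v: "v \<in> carrier_vec (Suc m)" by (simp add: v_def)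
  have adj: "adj_mat A \<in> carrier_mat (Suc m) (Suc m)" using adj_mat(1) [OF A] .
  have Av: "(A *\<^sub>v v) $ i \<in> odd_ideal n" if i: "i < Suc m" for i
  proof -
    let ?r = "int (l i) - int i + int m"
    have "(A *\<^sub>v v) $ i = (\<Sum>j<Suc m. h_even n (int (l i) - int i + int j) * e_coeff n (2 * (m - j)))"
      using i by (simp add: A_def v_def scalar_prod_def atLeast0LessThan del: sum.lessThan_Suc)
    also have "\<dots> = (\<Sum>k<Suc m. h_even n (int (l i) - int i + int (m - k)) * e_coeff n (2 * (m - (m - k))))"
      using sum.nat_diff_reindex [of "\<lambda>j. h_even n (int (l i) - int i + int j) * e_coeff n (2 * (m - j))" "Suc m"]
      by (simp del: sum.lessThan_Suc)
    also have "\<dots> = (\<Sum>k\<le>m. e_coeff n (2 * k) * h_even n (?r - int k))"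
      unfolding lessThan_Suc_atMost
    proof (intro sum.cong refl)
      fix k assume "k \<in> {..m}"
      hence "int (l i) - int i + int (m - k) = ?r - int k" "m - (m - k) = k" by auto
      thus "h_even n (int (l i) - int i + int (m - k)) * e_coeff n (2 * (m - (m - k)))
          = e_coeff n (2 * k) * h_even n (?r - int k)" by (simp only: mult.commute)
    qed
    also have "\<dots> \<in> odd_ideal n"
      unfolding m_def by (rule h_even_recurrence) (use l [of i] i in \<open>simp add: m_def\<close>)
    finally show ?thesis .
  qed
  have "adj_mat A $$ (m, j) \<in> psum_algebra n" if "j < Suc m" for j
  proof -
    have "det (mat_delete A j m) \<in> psum_algebra n"
    proof (rule det_in_psum_algebra)
      show "mat_delete A j m \<in> carrier_mat m m" using mat_delete_carrier [OF A] by simp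
    qed (auto simp: mat_delete_def A_def h_even_in_psum_algebra)
    thus ?thesis using that A
      by (simp add: adj_mat_def cofactor_def psum_algebra.mult psum_algebra_power psum_algebra_uminus psum_algebra_1)
  qed
  hence "(\<Sum>j\<in>{0..<Suc m}. adj_mat A $$ (m, j) * (A *\<^sub>v v) $ j) \<in> odd_ideal n"
    using Av by (intro odd_ideal_sum odd_ideal_mult_left) auto
  also have "(\<Sum>j\<in>{0..<Suc m}. adj_mat A $$ (m, j) * (A *\<^sub>v v) $ j) = (adj_mat A *\<^sub>v (A *\<^sub>v v)) $ m"
    using adj A v by (simp add: scalar_prod_def)
  also have "adj_mat A *\<^sub>v (A *\<^sub>v v) = (det A \<cdot>\<^sub>m 1\<^sub>m (Suc m)) *\<^sub>v v"
    using adj_mat(3) [OF A] assoc_mult_mat_vec [OF adj A v] by simp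
  also have "\<dots> $ m = det A"
    using smult_scalar_prod_distrib [OF unit_vec_carrier v] scalar_prod_left_unit [OF v] by (simp add: v_def)
  finally show ?thesis by (simp add: A_def)
qed

section \<open>Reduction modulo the ideal to complex combinations of the basis\<close>

definition hspan :: "nat \<Rightarrow> mpoly set" where
  "hspan n = cvs.span (hbasis n ` {M. size M = n div 2})"

text \<open>Modulo the ideal the ring \<open>Rodd n\<close> collapses to the constants, so spanning
  over \<open>Rodd n\<close> turns into spanning over the complex numbers.\<close>

definition straight :: "nat \<Rightarrow> mpoly set" where
  "straight n = {f. \<exists>g\<in>hspan n. f - g \<in> odd_ideal n}"

lemma hspan_subset_straight: "hspan n \<subseteq> straight n"
  by (auto simp: straight_def intro!: bexI odd_ideal.zero)

lemma odd_ideal_subset_straight: "odd_ideal n \<subseteq> straight n"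
proof
  fix p assume "p \<in> odd_ideal n"
  moreover have "0 \<in> hspan n" by (simp add: hspan_def cvs.span_zero)
  ultimately show "p \<in> straight n" unfolding straight_def by (intro CollectI bexI [of _ 0]) simp_all
qed

lemma straight_add:
  assumes "f \<in> straight n" "f' \<in> straight n"
  shows "f + f' \<in> straight n"
proof -
  obtain g g' where "g \<in> hspan n" "f - g \<in> odd_ideal n" "g' \<in> hspan n" "f' - g' \<in> odd_ideal n"
    using assms by (auto simp: straight_def)
  hence "g + g' \<in> hspan n" "(f + f') - (g + g') \<in> odd_ideal n"
    using odd_ideal.add [of "f - g" n "f' - g'"] by (simp_all add: hspan_def cvs.span_add algebra_simps)
  thus ?thesis by (auto simp: straight_def)
qed

lemma straight_const_mult:
  assumes "f \<in> straight n"
  shows "const_mp c * f \<in> straight n"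
proof -
  obtain g where "g \<in> hspan n" "f - g \<in> odd_ideal n"
    using assms by (auto simp: straight_def)
  hence "const_mp c * g \<in> hspan n" "const_mp c * f - const_mp c * g \<in> odd_ideal n"
    using odd_ideal_mult_left [OF _ psum_algebra.const, of "f - g" n c]
    by (simp_all only: hspan_def span_const_mult right_diff_distrib)
  thus ?thesis by (auto simp: straight_def)
qed

lemma straight_uminus: "f \<in> straight n \<Longrightarrow> - f \<in> straight n"
  using straight_const_mult [of f n "-1"] by (simp add: const_mp_uminus)

lemma straight_0: "0 \<in> straight n"
  using odd_ideal_subset_straight odd_ideal.zero by blast

lemma straight_diff: "f \<in> straight n \<Longrightarrow> f' \<in> straight n \<Longrightarrow> f - f' \<in> straight n"
  using straight_add [OF _ straight_uminus, of f n f'] by simp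

lemma straight_sum: "(\<And>x. x \<in> A \<Longrightarrow> f x \<in> straight n) \<Longrightarrow> sum f A \<in> straight n"
  by (induction A rule: infinite_finite_induct) (simp_all add: straight_0 straight_add)

text \<open>At the least index i moved by \<sigma>, the image is larger than i, so a_i exceeds l_i,
  while earlier entries are unchanged. The at most m + 1 remaining summands on the left are each at
  most (m + 2)^(l_i), as l is decreasing; the base m + 2 makes the single term at a_i outweigh them
  all.\<close>

lemma sum_power_permute_less:
  fixes l a :: "nat \<Rightarrow> nat"
  assumes \<sigma>: "\<sigma> permutes {0..<Suc m}" "\<sigma> \<noteq> id"
    and l: "\<And>i j. i \<le> j \<Longrightarrow> j \<le> m \<Longrightarrow> l j \<le> l i"
    and a: "\<And>i. i \<le> m \<Longrightarrow> int (a i) = int (l i) - int i + int (\<sigma> i)"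
  shows "(\<Sum>i<Suc m. (m + 2) ^ l i) < (\<Sum>i<Suc m. (m + 2) ^ a i)"
proof -
  let ?B = "m + 2"
  define i where "i = (LEAST i. \<sigma> i \<noteq> i)"
  obtain i0 where "\<sigma> i0 \<noteq> i0" using \<sigma>(2) by (auto simp: fun_eq_iff)
  hence i: "\<sigma> i \<noteq> i" unfolding i_def by (rule LeastI)
  have below: "\<sigma> j = j" if "j < i" for j
    using not_less_Least that unfolding i_def by blast
  have im: "i \<le> m"
    using permutes_not_in [OF \<sigma>(1), of i] i by force
  have "\<sigma> i > i"
  proof (rule ccontr)
    assume "\<not> \<sigma> i > i"
    hence "\<sigma> (\<sigma> i) = \<sigma> i" using i by (intro below) simp
    thus False using permutes_inj [OF \<sigma>(1)] i by (simp add: inj_eq)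
  qed
  hence ai: "a i \<ge> Suc (l i)" using a [OF im] by linarith
  have split: "(\<Sum>j<Suc m. f j) = (\<Sum>j<i. f j) + (\<Sum>j\<in>{i..<Suc m}. f j)" for f :: "nat \<Rightarrow> nat"
    using sum.atLeastLessThan_concat [of 0 i "Suc m" f] im by (simp only: atLeast0LessThan)
  have "(\<Sum>j\<in>{i..<Suc m}. ?B ^ l j) \<le> (\<Sum>j\<in>{i..<Suc m}. ?B ^ l i)"
    using l by (intro sum_mono power_increasing) auto
  also have "\<dots> \<le> (m + 1) * ?B ^ l i"
    using mult_le_mono1 [of "Suc m - i" "m + 1" "?B ^ l i"] by simp
  also have "\<dots> < ?B ^ Suc (l i)" by simp
  also have "\<dots> \<le> ?B ^ a i" using ai by (intro power_increasing) auto
  also have "\<dots> \<le> (\<Sum>j\<in>{i..<Suc m}. ?B ^ a j)"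
    using im by (intro member_le_sum) auto
  finally have "(\<Sum>j\<in>{i..<Suc m}. ?B ^ l j) < (\<Sum>j\<in>{i..<Suc m}. ?B ^ a j)" .
  moreover have "(\<Sum>j<i. ?B ^ l j) = (\<Sum>j<i. ?B ^ a j)"
  proof (intro sum.cong refl)
    fix j assume "j \<in> {..<i}"
    hence "int (a j) = int (l j)" using a [of j] below [of j] im by simp
    thus "?B ^ l j = ?B ^ a j" by simp
  qed
  ultimately show ?thesis unfolding split by linarith
qed

text \<open>The non-identity terms of the Jacobi--Trudi determinant keep the weight of \<open>K\<close> and strictly
  increase \<open>\<Sum>x\<in>#K. (m + 2) ^ x\<close>, which is bounded for fixed weight.\<close>

lemma hbasis_Suc_in_straight:
  fixes n :: nat
  defines "m \<equiv> n div 2"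
  assumes "size K = Suc m"
  shows "hbasis n K \<in> straight n"
  using assms(2)
proof (induction "Suc m * (m + 2) ^ \<Sum>\<^sub># K - (\<Sum>x\<in>#K. (m + 2) ^ x)" arbitrary: K rule: less_induct)
  case less
  show ?case
  proof (cases "0 \<in># K")
    case True
    then obtain K' where K': "K = add_mset 0 K'" by (metis mset_add)
    hence "hbasis n K = hbasis n K'" by (simp add: hbasis_def)
    also have "\<dots> \<in> hspan n"
      using less.prems K' unfolding hspan_def m_def by (intro cvs.span_base imageI) simp
    finally show ?thesis using hspan_subset_straight by blast
  next
    case False
    define ls where "ls = rev (sorted_list_of_multiset K)"
    define l where "l i = ls ! i" for i
    have len: "length ls = Suc m" using less.prems by (simp add: ls_def flip: size_mset)
    have "mset ls = K" by (simp add: ls_def)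
    hence K: "K = image_mset l (mset_set {0..<Suc m})"
      using len by (metis l_def map_nth mset_map mset_upt map_eq_conv)
    have anti: "l j \<le> l i" if "i \<le> j" "j \<le> m" for i j
    proof -
      have "sorted (rev ls)" by (simp add: ls_def)
      thus ?thesis using that len unfolding l_def by (intro sorted_rev_nth_mono) auto
    qed
    \<comment> \<open>Positivity is what the recurrence behind the determinant asks for; row m uses
      it at r = l_m.\<close>
    have pos: "l i \<ge> 1" if "i \<le> m" for i
    proof -
      have "l i \<in># K" using that by (simp add: K)
      thus ?thesis using False by (cases "l i") auto
    qed
    have hb: "hbasis n (image_mset b (mset_set {0..<Suc m})) = (\<Prod>i=0..<Suc m. hcomp n (2 * b i))" for b
      by (simp add: hbasis_def prod_unfold_prod_mset image_mset.compositionality comp_def)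
    define t where "t \<sigma> = (\<Prod>i=0..<Suc m. h_even n (int (l i) - int i + int (\<sigma> i)))" for \<sigma>
    let ?P = "{\<sigma>. \<sigma> permutes {0..<Suc m}}"
    have "det (mat (Suc m) (Suc m) (\<lambda>(i, j). h_even n (int (l i) - int i + int j))) \<in> odd_ideal n"
      unfolding m_def by (rule det_h_even_in_odd_ideal) (use pos in \<open>simp add: m_def\<close>)
    also have "det (mat (Suc m) (Suc m) (\<lambda>(i, j). h_even n (int (l i) - int i + int j)))
        = (\<Sum>\<sigma>\<in>?P. signof \<sigma> * t \<sigma>)"
    proof (subst det_def' [of _ "Suc m"], simp, intro sum.cong refl)
      fix \<sigma> assume "\<sigma> \<in> ?P"
      hence "\<sigma> i < Suc m" if "i < Suc m" for i
        using permutes_in_image [of \<sigma> "{0..<Suc m}" i] that by simp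
      thus "signof \<sigma> * (\<Prod>i=0..<Suc m. mat (Suc m) (Suc m) (\<lambda>(i, j). h_even n (int (l i) - int i + int j)) $$ (i, \<sigma> i))
          = signof \<sigma> * t \<sigma>"
        unfolding t_def by (intro arg_cong2 [where f = "(*)"] prod.cong refl) simp
    qed
    also have "\<dots> = t id + (\<Sum>\<sigma>\<in>?P - {id}. signof \<sigma> * t \<sigma>)"
      by (subst sum.remove [of _ id]) (auto simp: finite_permutations permutes_id sign_id)
    also have "t id = hbasis n K"
      by (simp add: t_def K hb h_even_def del: prod.op_ivl_Suc)
    finally have det: "hbasis n K + (\<Sum>\<sigma>\<in>?P - {id}. signof \<sigma> * t \<sigma>) \<in> straight n"
      using odd_ideal_subset_straight by blast
    have "t \<sigma> \<in> straight n" if \<sigma>: "\<sigma> permutes {0..<Suc m}" "\<sigma> \<noteq> id" for \<sigma>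
    proof (cases "\<exists>i\<le>m. int (l i) - int i + int (\<sigma> i) < 0")
      case True
      hence "t \<sigma> = 0" unfolding t_def by (intro prod_zero) (auto simp: h_even_def)
      thus ?thesis by (simp add: straight_0)
    next
      case False
      define a where "a i = nat (int (l i) - int i + int (\<sigma> i))" for i
      have a: "int (a i) = int (l i) - int i + int (\<sigma> i)" if "i \<le> m" for i
        using False that by (auto simp: a_def not_less)
      define L where "L = image_mset a (mset_set {0..<Suc m})"
      have "t \<sigma> = hbasis n L"
        unfolding L_def hb t_def by (intro prod.cong refl) (use False in \<open>auto simp: h_even_def a_def\<close>)
      have size: "size L = Suc m" by (simp add: L_def)
      \<comment> \<open>The weight is preserved because the shifts - i and + \<sigma> i cancel in
        total.\<close>
      have "int (\<Sum>\<^sub># L) = (\<Sum>i=0..<Suc m. int (l i) - int i + int (\<sigma> i))"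
        unfolding L_def sum_unfold_sum_mset [symmetric] of_nat_sum by (intro sum.cong refl a) simp
      also have "\<dots> = (\<Sum>i=0..<Suc m. int (l i)) - (\<Sum>i=0..<Suc m. int i) + (\<Sum>i=0..<Suc m. int (\<sigma> i))"
        by (simp only: sum.distrib sum_subtractf)
      also have "(\<Sum>i=0..<Suc m. int (\<sigma> i)) = (\<Sum>i=0..<Suc m. int i)"
        using sum.permute [OF \<sigma>(1), of int] by (simp only: comp_def)
      also have "(\<Sum>i=0..<Suc m. int (l i)) = int (\<Sum>\<^sub># K)"
        unfolding K sum_unfold_sum_mset [symmetric] of_nat_sum ..
      finally have sum: "\<Sum>\<^sub># L = \<Sum>\<^sub># K" by (simp only: diff_add_cancel of_nat_eq_iff)
      \<comment> \<open>No part exceeds the weight, so the truncated subtraction in the induction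
        measure is exact and a larger power sum gives a smaller measure.\<close>
      have "(\<Sum>x\<in>#L. (m + 2) ^ x) \<le> (\<Sum>x\<in>#L. (m + 2) ^ \<Sum>\<^sub># L)"
      proof (rule sum_mset_mono)
        fix x assume "x \<in># L"
        then obtain L' where "L = add_mset x L'" by (rule mset_add)
        hence "x \<le> \<Sum>\<^sub># L" by simp
        thus "(m + 2) ^ x \<le> (m + 2) ^ \<Sum>\<^sub># L" by (intro power_increasing) auto
      qed
      hence "(\<Sum>x\<in>#L. (m + 2) ^ x) \<le> Suc m * (m + 2) ^ \<Sum>\<^sub># K"
        by (simp add: size sum)
      moreover have "(\<Sum>x\<in>#K. (m + 2) ^ x) < (\<Sum>x\<in>#L. (m + 2) ^ x)"
        using sum_power_permute_less [OF \<sigma> anti a]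
        by (simp add: K L_def image_mset.compositionality comp_def atLeast0LessThan
            flip: sum_unfold_sum_mset del: sum.lessThan_Suc)
      ultimately have "hbasis n L \<in> straight n"
        using less.hyps [of L] size unfolding sum by linarith
      thus ?thesis using \<open>t \<sigma> = hbasis n L\<close> by simp
    qed
    hence "signof \<sigma> * t \<sigma> \<in> straight n" if "\<sigma> \<in> ?P - {id}" for \<sigma>
      using that signof_cases [of \<sigma>] straight_uminus [of "t \<sigma>" n] by auto
    hence "(\<Sum>\<sigma>\<in>?P - {id}. signof \<sigma> * t \<sigma>) \<in> straight n" by (rule straight_sum)
    with det show ?thesis using straight_diff by fastforce
  qed
qed

text \<open>For odd k the product falls into the ideal. For even k each basis element becomes a
  product of \<open>n div 2 + 1\<close> even h, which \<open>hbasis_Suc_in_straight\<close>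
  rewrites.\<close>

lemma straight_mult_hcomp:
  assumes "f \<in> straight n"
  shows "hcomp n k * f \<in> straight n"
proof (cases "odd k")
  case True
  obtain g where g: "g \<in> hspan n" "f - g \<in> odd_ideal n"
    using assms by (auto simp: straight_def)
  have "g \<in> psum_algebra n"
    using g(1) unfolding hspan_def
  proof (induction rule: span_induct_const)
    case (step c x y)
    thus ?case using hbasis_in_psum_algebra by (auto intro!: psum_algebra.add psum_algebra.mult psum_algebra.const)
  qed (rule psum_algebra_0)
  hence "hcomp n k * (f - g) + hcomp n k * g \<in> odd_ideal n"
    using g(2) True by (intro odd_ideal.add odd_ideal_mult hcomp_odd odd_ideal_mult_left hcomp_in_psum_algebra)
  hence "hcomp n k * f \<in> odd_ideal n" by (simp add: right_diff_distrib)
  thus ?thesis using odd_ideal_subset_straight by blast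
next
  case False
  then obtain i where k: "k = 2 * i" by auto
  obtain g where g: "g \<in> hspan n" "f - g \<in> odd_ideal n"
    using assms by (auto simp: straight_def)
  have "hcomp n k * g \<in> straight n"
    using g(1) unfolding hspan_def
  proof (induction rule: span_induct_const)
    case (step c x y)
    then obtain M where M: "x = hbasis n M" "size M = n div 2" by auto
    have "hcomp n k * x = hbasis n (add_mset i M)" by (simp add: M k hbasis_def)
    hence "hcomp n k * x \<in> straight n" using hbasis_Suc_in_straight M(2) by simp
    hence "const_mp c * (hcomp n k * x) + hcomp n k * y \<in> straight n"
      using step by (intro straight_add straight_const_mult)
    thus ?case by (simp only: distrib_left mult.left_commute)
  qed (simp add: straight_0)
  moreover have "hcomp n k * (f - g) \<in> straight n"
    using g(2) odd_ideal_mult_left hcomp_in_psum_algebra odd_ideal_subset_straight by blast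
  ultimately have "hcomp n k * (f - g) + hcomp n k * g \<in> straight n"
    by (intro straight_add)
  thus ?thesis by (simp add: right_diff_distrib)
qed

text \<open>Newton's identity expresses p_k by h_k and products of smaller p_i with h; these p_i act
  on \<open>hcomp n (k - i) * f\<close>, so \<open>f\<close> must be arbitrary in the
  induction.\<close>

lemma straight_mult_psum: "f \<in> straight n \<Longrightarrow> psum n k * f \<in> straight n"
proof (induction k arbitrary: f rule: less_induct)
  case (less k)
  show ?case
  proof (cases "k = 0")
    case True
    have "psum n 0 = const_mp (of_nat n)" by (simp add: psum_def const_mp_of_nat)
    thus ?thesis using True straight_const_mult [OF less.prems] by simp
  next
    case False
    hence "k > 0" by simp
    hence "psum n k * f = const_mp (of_nat k) * (hcomp n k * f) - (\<Sum>i\<in>{1..<k}. psum n i * (hcomp n (k - i) * f))"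
      by (simp only: psum_eq_hcomp const_mp_of_nat left_diff_distrib sum_distrib_right mult.assoc)
    also have "\<dots> \<in> straight n"
      using less by (intro straight_diff straight_const_mult straight_mult_hcomp straight_sum less.IH) auto
    finally show ?thesis .
  qed
qed

text \<open>Closure of \<open>straight n\<close> under products is not visible, so it is treated as
  a module: the generators preserve it, and it contains 1, the basis element of the multiset of
  zeros.\<close>

lemma psum_algebra_subset_straight: "psum_algebra n \<subseteq> straight n"
proof
  fix p assume "p \<in> psum_algebra n"
  hence "p * f \<in> straight n" if "f \<in> straight n" for f
    using that
  proof (induction p arbitrary: f rule: psum_algebra.induct)
    case (add p q)
    thus ?case by (simp add: distrib_right straight_add)
  next
    case (mult p q)
    thus ?case by (simp add: mult.assoc)
  qed (simp_all add: straight_const_mult straight_mult_psum)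
  moreover have "1 \<in> straight n"
  proof -
    have "hbasis n (replicate_mset (n div 2) 0) = 1" by (simp add: hbasis_def)
    hence "1 \<in> hspan n" unfolding hspan_def by (intro cvs.span_base) (force intro: image_eqI)
    thus ?thesis using hspan_subset_straight by blast
  qed
  ultimately show "p \<in> straight n" by fastforce
qed

subsection \<open>Spanning over the odd power sums\<close>

definition odd_multisets :: "nat \<Rightarrow> nat multiset set" where
  "odd_multisets n = {N. \<forall>k\<in>#N. odd k \<and> k \<le> n}"

definition psum_prod :: "nat \<Rightarrow> nat multiset \<Rightarrow> mpoly" where
  "psum_prod n N = (\<Prod>k\<in>#N. psum n k)"

definition index_set :: "nat \<Rightarrow> (nat multiset \<times> nat multiset) set" where
  "index_set n = odd_multisets n \<times> {M. size M = n div 2}"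

definition index_deg :: "nat multiset \<times> nat multiset \<Rightarrow> nat" where
  "index_deg = (\<lambda>(N, M). \<Sum>\<^sub># N + 2 * \<Sum>\<^sub># M)"

text \<open>The candidate complex basis. Since the \<open>psum_prod\<close> span
  \<open>Rodd n\<close>, both halves of freeness can be read off from it by grouping the pairs by
  their second component.\<close>

definition family :: "nat \<Rightarrow> nat multiset \<times> nat multiset \<Rightarrow> mpoly" where
  "family n = (\<lambda>(N, M). psum_prod n N * hbasis n M)"

lemma homogeneous_psum_prod: "homogeneous (\<Sum>\<^sub># N) (psum_prod n N)"
proof (induction N)
  case (add k N)
  thus ?case using homogeneous_mult [OF homogeneous_psum [of k n]] by (simp add: psum_prod_def)
qed (simp add: psum_prod_def homogeneous_one)

lemma homogeneous_family: "homogeneous (index_deg x) (family n x)"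
  using homogeneous_mult [OF homogeneous_psum_prod homogeneous_hbasis]
  by (simp add: index_deg_def family_def split_beta)

lemma span_family_mult_psum:
  assumes "f \<in> cvs.span (family n ` index_set n)" "odd k" "k \<le> n"
  shows "psum n k * f \<in> cvs.span (family n ` index_set n)"
  using assms(1)
proof (induction rule: span_induct_const)
  case (step c x y)
  then obtain N M where x: "x = family n (N, M)" "(N, M) \<in> index_set n" by auto
  have "psum n k * x = family n (add_mset k N, M)"
    by (simp add: x(1) family_def psum_prod_def mult.assoc)
  moreover have "(add_mset k N, M) \<in> index_set n"
    using x(2) assms(2,3) by (auto simp: index_set_def odd_multisets_def)
  ultimately have "psum n k * x \<in> cvs.span (family n ` index_set n)"
    by (simp add: cvs.span_base)
  hence "const_mp c * (psum n k * x) + psum n k * y \<in> cvs.span (family n ` index_set n)"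
    using step by (intro cvs.span_add span_const_mult)
  thus ?case by (simp only: distrib_left mult.left_commute)
qed (simp add: cvs.span_zero)

lemma hspan_hom_comp: "g \<in> hspan n \<Longrightarrow> hom_comp d g \<in> cvs.span (family n ` index_set n)"
  unfolding hspan_def
proof (induction rule: span_induct_const)
  case (step c x y)
  then obtain M where M: "x = hbasis n M" "size M = n div 2" by auto
  have "x = family n ({#}, M)" "({#}, M) \<in> index_set n"
    using M by (simp_all add: family_def psum_prod_def index_set_def odd_multisets_def)
  hence "x \<in> cvs.span (family n ` index_set n)" by (simp add: cvs.span_base)
  hence "hom_comp d x \<in> cvs.span (family n ` index_set n)"
    using hom_comp_homogeneous [OF homogeneous_hbasis] M(1) by (simp add: cvs.span_zero)
  thus ?case using step by (simp only: hom_comp_add hom_comp_const_mult cvs.span_add span_const_mult)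
qed (simp add: cvs.span_zero)

text \<open>Graded Nakayama lemma: induction on the degree.\<close>

lemma hom_comp_in_span_family:
  "f \<in> psum_algebra n \<Longrightarrow> hom_comp d f \<in> cvs.span (family n ` index_set n)"
proof (induction d arbitrary: f rule: less_induct)
  case (less d)
  let ?W = "cvs.span (family n ` index_set n)"
  have ideal: "hom_comp d p \<in> ?W" if "p \<in> odd_ideal n" for p
    using that
  proof (induction p rule: odd_ideal.induct)
    case (gen k q)
    show ?case
    proof (cases "k \<le> d")
      case True
      \<comment> \<open>An odd generator has positive degree, so its cofactor is needed only in
        degree d - k < d.\<close>
      have "k > 0" using gen(1) by (rule odd_pos)
      hence "hom_comp (d - k) q \<in> ?W" using True gen by (intro less.IH) auto
      hence "psum n k * hom_comp (d - k) q \<in> ?W" using gen by (intro span_family_mult_psum)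
      thus ?thesis using True by (simp add: hom_comp_mult [OF homogeneous_psum])
    next
      case False
      thus ?thesis by (simp add: hom_comp_mult [OF homogeneous_psum] cvs.span_zero)
    qed
  qed (simp_all add: hom_comp_add cvs.span_add cvs.span_zero)
  obtain g where g: "g \<in> hspan n" "f - g \<in> odd_ideal n"
    using less.prems psum_algebra_subset_straight by (auto simp: straight_def)
  have "hom_comp d (g + (f - g)) \<in> ?W"
    unfolding hom_comp_add using g by (intro cvs.span_add hspan_hom_comp ideal)
  thus ?case by simp
qed

lemma psum_algebra_subset_span_family: "psum_algebra n \<subseteq> cvs.span (family n ` index_set n)"
proof
  fix f assume f: "f \<in> psum_algebra n"
  obtain N where "f = (\<Sum>d<N. hom_comp d f)" by (rule exE [OF sum_hom_comp])
  thus "f \<in> cvs.span (family n ` index_set n)"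
    using cvs.span_sum [of "{..<N}" "\<lambda>d. hom_comp d f"] hom_comp_in_span_family [OF f] by simp
qed

subsection \<open>Counting multisets\<close>

text \<open>The recursion for partitions with at most k + 1 parts, padded by zeros: either a padding
  zero is present, or 1 can be subtracted from every part.\<close>

lemma size_multisets_Suc:
  "{M. size M = Suc k \<and> \<Sum>\<^sub># M = d} = add_mset 0 ` {M. size M = k \<and> \<Sum>\<^sub># M = d}
    \<union> (if Suc k \<le> d then image_mset Suc ` {M. size M = Suc k \<and> \<Sum>\<^sub># M = d - Suc k} else {})"
  (is "?L = ?A \<union> ?B")
proof (intro equalityI subsetI)
  have sum_Suc: "\<Sum>\<^sub># (image_mset Suc M) = \<Sum>\<^sub># M + size M" for M
    by (induction M) simp_all
  fix M assume M: "M \<in> ?L"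
  show "M \<in> ?A \<union> ?B"
  proof (cases "0 \<in># M")
    case True
    then obtain M' where "M = add_mset 0 M'" by (metis mset_add)
    thus ?thesis using M by auto
  next
    case False
    define M' where "M' = image_mset (\<lambda>x. x - 1) M"
    have "image_mset (Suc \<circ> (\<lambda>x. x - 1)) M = image_mset id M"
      using False by (intro image_mset_cong) (auto, metis Suc_pred gr0I)
    hence "M = image_mset Suc M'" by (simp add: M'_def image_mset.compositionality)
    moreover from this M have "size M' = Suc k" "\<Sum>\<^sub># M' + Suc k = d" by (auto simp: sum_Suc)
    ultimately show ?thesis by auto
  qed
next
  have sum_Suc: "\<Sum>\<^sub># (image_mset Suc M) = \<Sum>\<^sub># M + size M" for M
    by (induction M) simp_all
  fix M assume "M \<in> ?A \<union> ?B"
  thus "M \<in> ?L" by (auto simp: sum_Suc split: if_splits)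
qed

text \<open>The matching recursion for partitions with parts at most k + 1, by presence of a part k
  + 1.\<close>

lemma bounded_multisets_Suc:
  "{N. set_mset N \<subseteq> {1..Suc k} \<and> \<Sum>\<^sub># N = d} = {N. set_mset N \<subseteq> {1..k} \<and> \<Sum>\<^sub># N = d}
    \<union> (if Suc k \<le> d then add_mset (Suc k) ` {N. set_mset N \<subseteq> {1..Suc k} \<and> \<Sum>\<^sub># N = d - Suc k} else {})"
  (is "?L = ?A \<union> ?B")
proof (intro equalityI subsetI)
  fix N assume N: "N \<in> ?L"
  show "N \<in> ?A \<union> ?B"
  proof (cases "Suc k \<in># N")
    case True
    then obtain N' where "N = add_mset (Suc k) N'" by (metis mset_add)
    thus ?thesis using N by auto
  next
    case False
    hence "set_mset N \<subseteq> {1..k}" using N by (fastforce simp: le_Suc_eq)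
    thus ?thesis using N by auto
  qed
qed (auto split: if_splits)

text \<open>Both counts obey the same recursion, with inner induction on the weight since the second
  summand keeps k + 1 and lowers d.\<close>

lemma card_size_multisets:
  "finite {M :: nat multiset. size M = k \<and> \<Sum>\<^sub># M = d} \<and> finite {N. set_mset N \<subseteq> {1..k} \<and> \<Sum>\<^sub># N = d}
    \<and> card {M :: nat multiset. size M = k \<and> \<Sum>\<^sub># M = d} = card {N. set_mset N \<subseteq> {1..k} \<and> \<Sum>\<^sub># N = d}"
proof (induction k arbitrary: d)
  case 0
  have "{M :: nat multiset. size M = 0 \<and> \<Sum>\<^sub># M = d} = (if d = 0 then {{#}} else {})"
    "{N :: nat multiset. set_mset N \<subseteq> {1..0} \<and> \<Sum>\<^sub># N = d} = (if d = 0 then {{#}} else {})"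
    by auto
  thus ?case by simp
next
  case (Suc k)
  show ?case
  proof (induction d rule: less_induct)
    case (less d)
    let ?P = "\<lambda>k d. {M :: nat multiset. size M = k \<and> \<Sum>\<^sub># M = d}"
    let ?Q = "\<lambda>k d. {N. set_mset N \<subseteq> {1..k} \<and> \<Sum>\<^sub># N = d}"
    have Suc_IH: "finite (?P k d)" "finite (?Q k d)" "card (?P k d) = card (?Q k d)"
      using Suc by blast+
    show ?case
    proof (cases "Suc k \<le> d")
      case True
      hence less_IH: "finite (?P (Suc k) (d - Suc k))" "finite (?Q (Suc k) (d - Suc k))"
        "card (?P (Suc k) (d - Suc k)) = card (?Q (Suc k) (d - Suc k))"
        using less [of "d - Suc k"] by auto
      have P: "?P (Suc k) d = add_mset 0 ` ?P k d \<union> image_mset Suc ` ?P (Suc k) (d - Suc k)"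
        using size_multisets_Suc [of k d] True by simp
      have Q: "?Q (Suc k) d = ?Q k d \<union> add_mset (Suc k) ` ?Q (Suc k) (d - Suc k)"
        using bounded_multisets_Suc [of k d] True by simp
      have "0 \<notin># image_mset Suc M" for M by auto
      hence "add_mset 0 ` ?P k d \<inter> image_mset Suc ` ?P (Suc k) (d - Suc k) = {}"
        by (metis (no_types, lifting) disjoint_iff imageE union_single_eq_member)
      hence "card (?P (Suc k) d) = card (?P k d) + card (?P (Suc k) (d - Suc k))"
        unfolding P using Suc_IH(1) less_IH(1)
        by (subst card_Un_disjoint) (simp_all add: card_image inj_on_def inj_eq [OF multiset.inj_map])
      moreover have "Suc k \<notin># N" if "N \<in> ?Q k d" for N using that by fastforce
      hence "?Q k d \<inter> add_mset (Suc k) ` ?Q (Suc k) (d - Suc k) = {}"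
        by (metis (no_types, lifting) disjoint_iff imageE union_single_eq_member)
      hence "card (?Q (Suc k) d) = card (?Q k d) + card (?Q (Suc k) (d - Suc k))"
        unfolding Q using Suc_IH(2) less_IH(2)
        by (subst card_Un_disjoint) (simp_all add: card_image inj_on_def)
      ultimately show ?thesis using Suc_IH less_IH P Q by simp
    next
      case False
      have P: "?P (Suc k) d = add_mset 0 ` ?P k d"
        using size_multisets_Suc [of k d] False by simp
      have Q: "?Q (Suc k) d = ?Q k d"
        using bounded_multisets_Suc [of k d] False by simp
      show ?thesis unfolding P Q using Suc_IH by (simp add: card_image inj_on_def)
    qed
  qed
qed

text \<open>Stands in for the transposition of Young diagrams: equal finite counts give a bijection
  for each weight, and these are glued along the weight.\<close>

lemma conjugation_bij:
  "\<exists>f. bij_betw f {M :: nat multiset. size M = k} {N. set_mset N \<subseteq> {1..k}} \<and> (\<forall>M. size M = k \<longrightarrow> \<Sum>\<^sub># (f M) = \<Sum>\<^sub># M)"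
proof -
  let ?P = "\<lambda>d. {M :: nat multiset. size M = k \<and> \<Sum>\<^sub># M = d}"
  let ?Q = "\<lambda>d. {N. set_mset N \<subseteq> {1..k} \<and> \<Sum>\<^sub># N = d}"
  have "\<forall>d. \<exists>f. bij_betw f (?P d) (?Q d)"
    using card_size_multisets [of k] by (intro allI finite_same_card_bij) auto
  from choice [OF this] obtain g where g: "\<And>d. bij_betw (g d) (?P d) (?Q d)" by (rule exE) (rule that, blast)
  define f where "f M = g (\<Sum>\<^sub># M) M" for M
  have f: "f M \<in> ?Q (\<Sum>\<^sub># M)" if "size M = k" for M
    using g [of "\<Sum>\<^sub># M"] that by (auto simp: f_def bij_betw_def)
  have "bij_betw f {M. size M = k} {N. set_mset N \<subseteq> {1..k}}"
  proof (rule bij_betw_imageI)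
    show "inj_on f {M. size M = k}"
    proof (rule inj_onI)
      fix M M' assume *: "M \<in> {M. size M = k}" "M' \<in> {M. size M = k}" "f M = f M'"
      hence "\<Sum>\<^sub># M = \<Sum>\<^sub># M'" using f [of M] f [of M'] by simp
      thus "M = M'" using * g [of "\<Sum>\<^sub># M"] by (auto simp: f_def bij_betw_def inj_on_def)
    qed
    show "f ` {M. size M = k} = {N. set_mset N \<subseteq> {1..k}}"
    proof (intro equalityI subsetI)
      fix N assume "N \<in> {N. set_mset N \<subseteq> {1..k}}"
      hence "N \<in> g (\<Sum>\<^sub># N) ` ?P (\<Sum>\<^sub># N)" using g [of "\<Sum>\<^sub># N"] by (auto simp: bij_betw_def)
      then obtain M where "size M = k" "\<Sum>\<^sub># M = \<Sum>\<^sub># N" "N = g (\<Sum>\<^sub># N) M" by blast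
      thus "N \<in> f ` {M. size M = k}" by (intro image_eqI [of _ _ M]) (simp_all add: f_def)
    qed (use f in auto)
  qed
  thus ?thesis using f by auto
qed

text \<open>An even part \<open>2k\<close> of a partition with parts at most \<open>n\<close> corresponds to a part \<open>k \<le> n div 2\<close>.\<close>

lemma index_injection:
  "\<exists>G. inj_on G ({N. \<forall>k\<in>#N. odd k \<and> k \<le> n} \<times> {M. size M = n div 2})
    \<and> (\<forall>N M. (\<forall>k\<in>#N. odd k \<and> k \<le> n) \<longrightarrow> size M = n div 2 \<longrightarrow>
        size (G (N, M)) = n \<and> \<Sum>\<^sub># (G (N, M)) = \<Sum>\<^sub># N + 2 * \<Sum>\<^sub># M)"
proof -
  obtain f where f: "bij_betw f {M :: nat multiset. size M = n div 2} {N. set_mset N \<subseteq> {1..n div 2}}"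
      "\<And>M. size M = n div 2 \<Longrightarrow> \<Sum>\<^sub># (f M) = \<Sum>\<^sub># M"
    using conjugation_bij [of "n div 2"] by blast
  obtain g where g: "bij_betw g {M :: nat multiset. size M = n} {N. set_mset N \<subseteq> {1..n}}"
      "\<And>M. size M = n \<Longrightarrow> \<Sum>\<^sub># (g M) = \<Sum>\<^sub># M"
    using conjugation_bij [of n] by blast
  let ?g' = "inv_into {M. size M = n} g"
  have g': "size (?g' N) = n" "\<Sum>\<^sub># (?g' N) = \<Sum>\<^sub># N" if "set_mset N \<subseteq> {1..n}" for N
  proof -
    have "N \<in> g ` {M. size M = n}" using g(1) that by (auto simp: bij_betw_def)
    hence "?g' N \<in> {M. size M = n}" "g (?g' N) = N" by (rule inv_into_into, rule f_inv_into_f)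
    thus "size (?g' N) = n" "\<Sum>\<^sub># (?g' N) = \<Sum>\<^sub># N" using g(2) [of "?g' N"] by simp_all
  qed
  \<comment> \<open>Doubling the conjugate of M gives even parts at most n, which are merged with
    the odd parts N; the inverse of \<open>g\<close> then turns parts bounded by n into exactly n
    parts, zeros included.\<close>
  define u where "u = (\<lambda>(N, M). N + image_mset ((*) 2) (f M))"
  have fM: "set_mset (f M) \<subseteq> {1..n div 2}" if "size M = n div 2" for M
    using f(1) that by (auto simp: bij_betw_def)
  have double: "\<Sum>\<^sub># (image_mset ((*) 2) X) = 2 * \<Sum>\<^sub># X" for X :: "nat multiset"
    by (induction X) simp_all
  have u: "set_mset (u (N, M)) \<subseteq> {1..n}" "\<Sum>\<^sub># (u (N, M)) = \<Sum>\<^sub># N + 2 * \<Sum>\<^sub># M"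
    if "\<forall>k\<in>#N. odd k \<and> k \<le> n" "size M = n div 2" for N M
  proof -
    show "set_mset (u (N, M)) \<subseteq> {1..n}"
      using that(1) fM [OF that(2)] by (fastforce simp: u_def Suc_le_eq odd_pos)
    show "\<Sum>\<^sub># (u (N, M)) = \<Sum>\<^sub># N + 2 * \<Sum>\<^sub># M"
      by (simp only: u_def prod.case sum_mset.union double f(2) [OF that(2)])
  qed
  \<comment> \<open>Parity separates the merged multiset again, which yields injectivity of
    \<open>u\<close>.\<close>
  have odd_part: "filter_mset odd (u (N, M)) = N" and even_part: "filter_mset even (u (N, M)) = image_mset ((*) 2) (f M)"
    if "\<forall>k\<in>#N. odd k \<and> k \<le> n" for N M
  proof -
    have "filter_mset odd N = N" "filter_mset even N = {#}"
      using that by (induction N) auto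
    thus "filter_mset odd (u (N, M)) = N" "filter_mset even (u (N, M)) = image_mset ((*) 2) (f M)"
      by (simp_all add: u_def filter_mset_image_mset)
  qed
  have "inj_on u ({N. \<forall>k\<in>#N. odd k \<and> k \<le> n} \<times> {M. size M = n div 2})"
  proof (rule inj_onI)
    fix x y
    assume "x \<in> {N. \<forall>k\<in>#N. odd k \<and> k \<le> n} \<times> {M. size M = n div 2}"
      "y \<in> {N. \<forall>k\<in>#N. odd k \<and> k \<le> n} \<times> {M. size M = n div 2}" and eq: "u x = u y"
    then obtain N M N' M' where *: "x = (N, M)" "y = (N', M')" "\<forall>k\<in>#N. odd k \<and> k \<le> n"
      "\<forall>k\<in>#N'. odd k \<and> k \<le> n" "size M = n div 2" "size M' = n div 2" by auto
    have "N = N'" using odd_part [OF *(3), of M] odd_part [OF *(4), of M'] eq *(1,2) by simp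
    have "image_mset ((*) 2) (f M) = image_mset ((*) 2) (f M')"
      using even_part [OF *(3), of M] even_part [OF *(4), of M'] eq *(1,2) by simp
    hence "f M = f M'" by (rule injD [OF multiset.inj_map, rotated]) (simp add: inj_def)
    hence "M = M'" using *(5,6) f(1) by (auto simp: bij_betw_def inj_on_def)
    thus "x = y" using \<open>N = N'\<close> * by simp
  qed
  moreover have "inj_on ?g' {N. set_mset N \<subseteq> {1..n}}"
    using bij_betw_inv_into [OF g(1)] by (auto simp: bij_betw_def)
  ultimately have "inj_on (?g' \<circ> u) ({N. \<forall>k\<in>#N. odd k \<and> k \<le> n} \<times> {M. size M = n div 2})"
    using u(1) by (intro comp_inj_on) (auto elim!: inj_on_subset)
  thus ?thesis using g' u by (intro exI [of _ "?g' \<circ> u"]) simp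
qed

subsection \<open>Independence by a dimension count\<close>

text \<open>The monomials of the monomial symmetric polynomial of the partition M. Zero exponents
  are recorded in M, so partitions with at most n parts are the multisets of size n.\<close>

definition orbit :: "nat \<Rightarrow> nat multiset \<Rightarrow> (nat \<Rightarrow>\<^sub>0 nat) set" where
  "orbit n M = {u. Poly_Mapping.keys u \<subseteq> {..<n} \<and> image_mset (Poly_Mapping.lookup u) (mset_set {..<n}) = M}"

lemma mdeg_orbit: "u \<in> orbit n M \<Longrightarrow> mdeg u = \<Sum>\<^sub># M"
  by (auto simp: orbit_def mdeg_eq_sum sum_unfold_sum_mset)

lemma finite_orbit: "finite (orbit n M)"
  by (rule finite_subset [OF _ finite_monomials [of n "\<Sum>\<^sub># M"]]) (auto simp: mdeg_orbit, auto simp: orbit_def)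

lemma orbit_nonempty:
  assumes "size M = n"
  shows "orbit n M \<noteq> {}"
proof -
  obtain ls where ls: "mset ls = M" using ex_mset by blast
  hence len: "length ls = n" using assms by auto
  define u where "u = (\<Sum>i<n. Poly_Mapping.single i (ls ! i))"
  have u: "Poly_Mapping.lookup u i = (if i < n then ls ! i else 0)" for i
    by (simp add: u_def lookup_sum lookup_single when_def)
  have "image_mset (Poly_Mapping.lookup u) (mset_set {..<n}) = image_mset ((!) ls) (mset_set {..<n})"
    by (intro image_mset_cong) (auto simp: u)
  also have "\<dots> = mset (map ((!) ls) [0..<n])" by (simp add: atLeast0LessThan)
  also have "map ((!) ls) [0..<n] = ls" using len map_nth by blast
  finally have "image_mset (Poly_Mapping.lookup u) (mset_set {..<n}) = M" using ls by simp
  moreover have "Poly_Mapping.keys u \<subseteq> {..<n}" by (auto simp: in_keys_iff u split: if_splits)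
  ultimately have "u \<in> orbit n M" by (simp add: orbit_def)
  thus ?thesis by blast
qed

lemma orbit_sum_in_Rn: "monomial_sum (orbit n M) \<in> Rn n"
proof (rule monomial_sum_in_Rn [OF finite_orbit])
  fix u \<sigma> assume u: "u \<in> orbit n M" and \<sigma>: "\<sigma> permutes {..<n}"
  have "Poly_Mapping.lookup (perm_mono \<sigma> u) = Poly_Mapping.lookup u \<circ> inv_into UNIV \<sigma>"
    by (simp add: fun_eq_iff lookup_perm_mono [OF \<sigma>])
  hence "image_mset (Poly_Mapping.lookup (perm_mono \<sigma> u)) (mset_set {..<n})
      = image_mset (Poly_Mapping.lookup u) (image_mset (inv_into UNIV \<sigma>) (mset_set {..<n}))"
    by (simp add: image_mset.compositionality)
  also have "image_mset (inv_into UNIV \<sigma>) (mset_set {..<n}) = mset_set {..<n}"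
    using permutes_inv [OF \<sigma>] by (simp add: image_mset_mset_set permutes_inj_on permutes_image)
  finally show "perm_mono \<sigma> u \<in> orbit n M"
    using u keys_perm_mono_subset [OF \<sigma>] by (simp add: orbit_def)
qed (simp add: orbit_def)

lemma homogeneous_orbit_sum: "homogeneous (\<Sum>\<^sub># M) (monomial_sum (orbit n M))"
  unfolding monomial_sum_def by (intro homogeneous_sum) (simp add: homogeneous_def mdeg_orbit)

lemma lookup_orbit_sum:
  "u \<in> orbit n M \<Longrightarrow> Poly_Mapping.lookup (monomial_sum (orbit n M')) u = (if M' = M then 1 else 0)"
  by (auto simp: lookup_monomial_sum finite_orbit) (auto simp: orbit_def)

lemma inj_on_orbit_sum: "inj_on (\<lambda>M. monomial_sum (orbit n M)) {M. size M = n}"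
proof (rule inj_onI)
  fix M M' assume *: "M \<in> {M. size M = n}" "monomial_sum (orbit n M) = monomial_sum (orbit n M')"
  from *(1) have "orbit n M \<noteq> {}" by (intro orbit_nonempty) simp
  then obtain u where u: "u \<in> orbit n M" by blast
  have "Poly_Mapping.lookup (monomial_sum (orbit n M')) u = 1"
    unfolding *(2) [symmetric] by (simp add: lookup_orbit_sum [OF u])
  thus "M = M'" unfolding lookup_orbit_sum [OF u] by (simp split: if_splits)
qed

text \<open>Orbits are disjoint and nonempty, so the coefficient at one monomial of an orbit
  isolates one scalar.\<close>

lemma independent_orbit_sums: "cvs.independent ((\<lambda>M. monomial_sum (orbit n M)) ` {M. size M = n})"
  unfolding cvs.independent_explicit_finite_subsets
proof (intro allI impI ballI)
  fix S c v
  assume S: "S \<subseteq> (\<lambda>M. monomial_sum (orbit n M)) ` {M. size M = n}" "finite S"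
    and sum: "(\<Sum>v\<in>S. cscale (c v) v) = 0" and v: "v \<in> S"
  then obtain M where M: "size M = n" "v = monomial_sum (orbit n M)" by auto
  obtain u where u: "u \<in> orbit n M" using orbit_nonempty [OF M(1)] by blast
  have "Poly_Mapping.lookup (\<Sum>v\<in>S. cscale (c v) v) u = (\<Sum>w\<in>S. if w = v then c w else 0)"
    unfolding lookup_sum
  proof (intro sum.cong refl)
    fix w assume "w \<in> S"
    then obtain M' where "size M' = n" "w = monomial_sum (orbit n M')" using S(1) by auto
    thus "Poly_Mapping.lookup (cscale (c w) w) u = (if w = v then c w else 0)"
      using lookup_orbit_sum [OF u, of M'] lookup_orbit_sum [OF u, of M] M(2)
      by (auto simp: cscale_def split: if_splits)
  qed
  also have "\<dots> = c v" using S(2) v by simp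
  finally show "c v = 0" by (simp add: sum)
qed

definition index_layer :: "nat \<Rightarrow> nat \<Rightarrow> (nat multiset \<times> nat multiset) set" where
  "index_layer n d = {x \<in> index_set n. index_deg x = d}"

lemma span_family_hom_comp:
  "f \<in> cvs.span (family n ` index_set n) \<Longrightarrow> hom_comp d f \<in> cvs.span (family n ` index_layer n d)"
proof (induction rule: span_induct_const)
  case (step c x y)
  then obtain z where z: "x = family n z" "z \<in> index_set n" by auto
  have "hom_comp d x \<in> cvs.span (family n ` index_layer n d)"
    using z by (auto simp: hom_comp_homogeneous [OF homogeneous_family] index_layer_def
        intro: cvs.span_zero cvs.span_base)
  thus ?case using step by (simp only: hom_comp_add hom_comp_const_mult cvs.span_add span_const_mult)
qed (simp add: cvs.span_zero)

text \<open>The injection into partitions supplies as many independent orbit sums as there are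
  indices of degree d, all in the span of the layer. Were two family members equal, or one
  redundant, that span would be generated by fewer vectors.\<close>

lemma family_layer:
  "finite (index_layer n d) \<and> inj_on (family n) (index_layer n d) \<and> cvs.independent (family n ` index_layer n d)"
proof -
  let ?X = "index_layer n d" and ?F = "family n ` index_layer n d"
  obtain G where G: "inj_on G (index_set n)"
      "\<And>x. x \<in> index_set n \<Longrightarrow> size (G x) = n \<and> \<Sum>\<^sub># (G x) = index_deg x"
    using index_injection [of n] by (auto simp: index_set_def odd_multisets_def index_deg_def)
  have injG: "inj_on G ?X" using G(1) by (rule inj_on_subset) (auto simp: index_layer_def)
  have GX: "G ` ?X \<subseteq> {M. size M = n \<and> \<Sum>\<^sub># M = d}" using G(2) by (auto simp: index_layer_def)
  hence "finite (G ` ?X)" by (rule finite_subset) (use card_size_multisets [of n d] in blast)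
  hence fin: "finite ?X" using injG by (rule finite_imageD)
  let ?T = "(\<lambda>M. monomial_sum (orbit n M)) ` G ` ?X"
  have T: "cvs.independent ?T"
    by (rule cvs.independent_mono [OF independent_orbit_sums]) (use GX in auto)
  have "inj_on (\<lambda>M. monomial_sum (orbit n M)) (G ` ?X)"
    by (rule inj_on_subset [OF inj_on_orbit_sum]) (use GX in auto)
  hence cardT: "card ?T = card ?X" by (simp add: card_image injG)
  \<comment> \<open>An orbit sum indexed by \<open>G x\<close> is homogeneous of degree d, so its
    expansion in the whole family can be cut down to this layer.\<close>
  have TF: "?T \<subseteq> cvs.span ?F"
  proof (clarify)
    fix x assume x: "x \<in> ?X"
    have "monomial_sum (orbit n (G x)) \<in> cvs.span (family n ` index_set n)"
      using orbit_sum_in_Rn Rn_subset_psum_algebra psum_algebra_subset_span_family by blast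
    from span_family_hom_comp [OF this, of d]
    show "monomial_sum (orbit n (G x)) \<in> cvs.span ?F"
      using GX x by (auto simp: hom_comp_homogeneous [OF homogeneous_orbit_sum])
  qed
  have "card ?T \<le> card ?F" using cvs.independent_span_bound [OF _ T TF] fin by simp
  hence cardF: "card ?F = card ?X" using cardT card_image_le [OF fin, of "family n"] by simp
  have "cvs.independent ?F"
  proof (rule ccontr)
    assume "\<not> cvs.independent ?F"
    then obtain a where a: "a \<in> ?F" "a \<in> cvs.span (?F - {a})" unfolding cvs.dependent_def by blast
    have "cvs.span ?F = cvs.span (?F - {a})"
      using cvs.span_redundant [OF a(2)] a(1) by (simp add: insert_absorb)
    hence "card ?T \<le> card (?F - {a})"
      using cvs.independent_span_bound [OF _ T, of "?F - {a}"] TF fin by simp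
    moreover have "card (?F - {a}) < card ?F" using a(1) fin by (intro psubset_card_mono) auto
    ultimately show False using cardT cardF by simp
  qed
  thus ?thesis using fin eq_card_imp_inj_on [OF fin cardF] by blast
qed

text \<open>Taking the component in the degree of \<open>x\<close> leaves a relation inside one
  layer. Injectivity there lets the coefficients, which belong to indices, be transferred to
  vectors.\<close>

lemma family_independent:
  assumes "finite A" "A \<subseteq> index_set n" "(\<Sum>x\<in>A. const_mp (a x) * family n x) = 0" "x \<in> A"
  shows "a x = 0"
proof -
  define d where "d = index_deg x"
  let ?A = "{y \<in> A. index_deg y = d}"
  have A: "?A \<subseteq> index_layer n d" using assms(2) by (auto simp: index_layer_def)
  have inj: "inj_on (family n) ?A" using family_layer A inj_on_subset by blast
  have "0 = hom_comp d (\<Sum>x\<in>A. const_mp (a x) * family n x)" by (simp add: assms(3))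
  also have "\<dots> = (\<Sum>x\<in>A. if index_deg x = d then const_mp (a x) * family n x else 0)"
    unfolding hom_comp_sum
    by (intro sum.cong refl) (simp add: hom_comp_const_mult hom_comp_homogeneous [OF homogeneous_family])
  also have "\<dots> = (\<Sum>x\<in>?A. const_mp (a x) * family n x)"
    using assms(1) by (simp add: sum.inter_filter)
  also have "\<dots> = (\<Sum>v\<in>family n ` ?A. cscale (a (the_inv_into ?A (family n) v)) v)"
    using inj by (simp add: sum.reindex cscale_def the_inv_into_f_f)
  finally have sum: "(\<Sum>v\<in>family n ` ?A. cscale (a (the_inv_into ?A (family n) v)) v) = 0" ..
  have "cvs.independent (family n ` index_layer n d)" using family_layer by blast
  moreover have "finite (family n ` ?A)" using assms(1) by simp
  moreover have "family n ` ?A \<subseteq> family n ` index_layer n d" using A by (rule image_mono)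
  moreover have "x \<in> ?A" using assms(4) by (simp add: d_def)
  hence "family n x \<in> family n ` ?A" by (rule imageI)
  ultimately have "a (the_inv_into ?A (family n) (family n x)) = 0"
    using sum by (intro cvs.independentD [where u = "\<lambda>v. a (the_inv_into ?A (family n) v)"])
  thus ?thesis using \<open>x \<in> ?A\<close> by (simp add: the_inv_into_f_f [OF inj])
qed

lemma span_image_explicit:
  assumes "q \<in> cvs.span (f ` X)"
  shows "\<exists>A a. finite A \<and> A \<subseteq> X \<and> q = (\<Sum>x\<in>A. const_mp (a x) * f x)"
proof -
  obtain t r where t: "finite t" "t \<subseteq> f ` X" "q = (\<Sum>v\<in>t. cscale (r v) v)"
    using assms unfolding cvs.span_explicit by auto
  then obtain A where A: "A \<subseteq> X" "inj_on f A" "t = f ` A" unfolding subset_image_inj by blast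
  have "finite A" using t(1) A by (simp add: finite_image_iff)
  moreover have "q = (\<Sum>x\<in>A. const_mp (r (f x)) * f x)"
    using t(3) A by (simp add: sum.reindex cscale_def)
  ultimately show ?thesis using A(1) by (intro exI [of _ A] exI [of _ "r \<circ> f"]) simp
qed

section \<open>Coefficients in the ring of odd power sums, and freeness\<close>

lemma Rodd_0: "0 \<in> Rodd n"
  using Rodd.const [of 0 n] by simp

lemma Rodd_sum: "(\<And>x. x \<in> A \<Longrightarrow> f x \<in> Rodd n) \<Longrightarrow> sum f A \<in> Rodd n"
  by (induction A rule: infinite_finite_induct) (simp_all add: Rodd_0 Rodd.add)

lemma psum_prod_in_Rodd: "N \<in> odd_multisets n \<Longrightarrow> psum_prod n N \<in> Rodd n"
proof (induction N)
  case empty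
  show ?case using Rodd.const [of 1 n] by (simp add: psum_prod_def)
next
  case (add k N)
  hence "odd k" "k \<le> n" "N \<in> odd_multisets n" by (auto simp: odd_multisets_def)
  moreover from this obtain j where "k = 2 * j + 1" by (auto elim: oddE)
  ultimately show ?case using add.IH Rodd.gen [of j n]
    by (auto simp: psum_prod_def intro: Rodd.mult)
qed

text \<open>For n \<ge> 1 the bound on j says 2 j + 1 \<le> n; at n = 0 truncated subtraction would
  let j = 0 through. Closure under products is bilinearity together with addition of
  multisets.\<close>

lemma Rodd_subset_span:
  assumes "n \<ge> 1"
  shows "Rodd n \<subseteq> cvs.span (psum_prod n ` odd_multisets n)"
proof
  let ?S = "psum_prod n ` odd_multisets n"
  have mult: "p * q \<in> cvs.span ?S" if "p \<in> cvs.span ?S" "q \<in> cvs.span ?S" for p q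
    using that(1)
  proof (induction rule: span_induct_const)
    case (step c x y)
    have "x * q \<in> cvs.span ?S"
      using that(2)
    proof (induction rule: span_induct_const)
      case (step c' x' y')
      then obtain N N' where "N \<in> odd_multisets n" "N' \<in> odd_multisets n" "x = psum_prod n N" "x' = psum_prod n N'"
        using \<open>x \<in> ?S\<close> by blast
      hence "x * x' = psum_prod n (N + N')" "N + N' \<in> odd_multisets n"
        by (auto simp: psum_prod_def odd_multisets_def)
      hence "x * x' \<in> cvs.span ?S" by (simp add: cvs.span_base)
      hence "const_mp c' * (x * x') + x * y' \<in> cvs.span ?S"
        using step by (intro cvs.span_add span_const_mult)
      thus ?case by (simp only: distrib_left mult.left_commute)
    qed (simp add: cvs.span_zero)
    hence "const_mp c * (x * q) + y * q \<in> cvs.span ?S"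
      using step by (intro cvs.span_add span_const_mult)
    thus ?case by (simp only: distrib_right mult.assoc)
  qed (simp add: cvs.span_zero)
  fix p assume "p \<in> Rodd n"
  thus "p \<in> cvs.span ?S"
  proof (induction rule: Rodd.induct)
    case (const c)
    have "psum_prod n {#} \<in> cvs.span ?S" by (intro cvs.span_base imageI) (simp add: odd_multisets_def)
    thus ?case using span_const_mult [of "psum_prod n {#}" ?S c] by (simp add: psum_prod_def)
  next
    case (gen j)
    have "psum_prod n {#2 * j + 1#} \<in> cvs.span ?S"
      using gen assms by (intro cvs.span_base imageI) (auto simp: odd_multisets_def)
    thus ?case by (simp add: psum_prod_def)
  qed (simp_all add: cvs.span_add mult)
qed

theorem mainTheorem4:
  fixes n :: nat
  assumes "n \<ge> 1"
  defines "B \<equiv> {M :: nat multiset. size M = n div 2}"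
  shows "(\<forall>M\<in>B. hbasis n M \<in> Rn n)
    \<and> (\<forall>p\<in>Rn n. \<exists>c :: nat multiset \<Rightarrow> mpoly.
          finite {M\<in>B. c M \<noteq> 0} \<and> (\<forall>M\<in>B. c M \<in> Rodd n) \<and>
          p = (\<Sum>M\<in>{M\<in>B. c M \<noteq> 0}. c M * hbasis n M))
    \<and> (\<forall>c :: nat multiset \<Rightarrow> mpoly.
          finite {M\<in>B. c M \<noteq> 0} \<longrightarrow> (\<forall>M\<in>B. c M \<in> Rodd n) \<longrightarrow>
          (\<Sum>M\<in>{M\<in>B. c M \<noteq> 0}. c M * hbasis n M) = 0 \<longrightarrow> (\<forall>M\<in>B. c M = 0))"
proof (intro conjI ballI allI impI)
  fix M show "hbasis n M \<in> Rn n" by (rule hbasis_in_Rn)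
next
  fix p assume "p \<in> Rn n"
  hence "p \<in> cvs.span (family n ` index_set n)"
    using Rn_subset_psum_algebra psum_algebra_subset_span_family by blast
  from span_image_explicit [OF this] obtain A a
    where A: "finite A" "A \<subseteq> index_set n" "p = (\<Sum>x\<in>A. const_mp (a x) * family n x)" by blast
  \<comment> \<open>All pairs of the complex expansion with second component M are collected into
    one coefficient.\<close>
  define c where "c M = (\<Sum>N\<in>{N. (N, M) \<in> A}. const_mp (a (N, M)) * psum_prod n N)" for M
  have fin: "finite {N. (N, M) \<in> A}" for M
    by (rule finite_subset [OF _ finite_imageI [OF A(1), of fst]]) force
  have c_0: "c M = 0" if "M \<notin> snd ` A" for M
  proof -
    have "{N. (N, M) \<in> A} = {}" using that by force
    thus ?thesis by (simp add: c_def)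
  qed
  have snd_A: "snd ` A \<subseteq> B" using A(2) by (auto simp: index_set_def B_def)
  have "p = (\<Sum>(N, M)\<in>A. const_mp (a (N, M)) * psum_prod n N * hbasis n M)"
    unfolding A(3) by (intro sum.cong) (auto simp: family_def mult.assoc)
  also have "\<dots> = (\<Sum>M\<in>snd ` A. \<Sum>x\<in>{x \<in> A. snd x = M}. (case x of (N, M) \<Rightarrow> const_mp (a (N, M)) * psum_prod n N * hbasis n M))"
    by (rule sum.image_gen [OF A(1)])
  also have "\<dots> = (\<Sum>M\<in>snd ` A. c M * hbasis n M)"
  proof (intro sum.cong refl)
    fix M
    have "{x \<in> A. snd x = M} = (\<lambda>N. (N, M)) ` {N. (N, M) \<in> A}" by force
    thus "(\<Sum>x\<in>{x \<in> A. snd x = M}. (case x of (N, M) \<Rightarrow> const_mp (a (N, M)) * psum_prod n N * hbasis n M))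
        = c M * hbasis n M"
      by (simp add: sum.reindex inj_on_def c_def sum_distrib_right)
  qed
  also have "\<dots> = (\<Sum>M\<in>{M\<in>B. c M \<noteq> 0}. c M * hbasis n M)"
    using snd_A c_0 A(1) by (intro sum.mono_neutral_right) auto
  finally have p: "p = (\<Sum>M\<in>{M\<in>B. c M \<noteq> 0}. c M * hbasis n M)" .
  have "finite {M\<in>B. c M \<noteq> 0}"
    by (rule finite_subset [OF _ finite_imageI [OF A(1), of snd]]) (use c_0 in auto)
  moreover have "c M \<in> Rodd n" for M
    unfolding c_def using A(2)
    by (intro Rodd_sum Rodd.mult Rodd.const psum_prod_in_Rodd) (auto simp: index_set_def)
  ultimately show "\<exists>c. finite {M\<in>B. c M \<noteq> 0} \<and> (\<forall>M\<in>B. c M \<in> Rodd n) \<and> p = (\<Sum>M\<in>{M\<in>B. c M \<noteq> 0}. c M * hbasis n M)"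
    using p by blast
next
  fix c :: "nat multiset \<Rightarrow> mpoly" and M
  let ?S = "{M\<in>B. c M \<noteq> 0}"
  assume fin: "finite ?S" and c: "\<forall>M\<in>B. c M \<in> Rodd n" and sum: "(\<Sum>M\<in>?S. c M * hbasis n M) = 0" and M: "M \<in> B"
  \<comment> \<open>Each coefficient is expanded in products of odd power sums, which turns the
    relation over \<open>Rodd n\<close> into a complex relation in the family. Support and scalars
    are paired in \<open>z\<close> so that one application of choice fixes both.\<close>
  have "\<forall>M\<in>B. \<exists>z. finite (fst z) \<and> fst z \<subseteq> odd_multisets n \<and> c M = (\<Sum>N\<in>fst z. const_mp (snd z N) * psum_prod n N)"
  proof
    fix M assume "M \<in> B"
    hence "c M \<in> cvs.span (psum_prod n ` odd_multisets n)" using Rodd_subset_span [OF assms(1)] c by blast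
    from span_image_explicit [OF this] obtain A a where "finite A" "A \<subseteq> odd_multisets n"
      "c M = (\<Sum>N\<in>A. const_mp (a N) * psum_prod n N)" by blast
    thus "\<exists>z. finite (fst z) \<and> fst z \<subseteq> odd_multisets n \<and> c M = (\<Sum>N\<in>fst z. const_mp (snd z N) * psum_prod n N)"
      by (intro exI [of _ "(A, a)"]) simp
  qed
  from bchoice [OF this] obtain z where z: "\<And>M. M \<in> B \<Longrightarrow> finite (fst (z M)) \<and> fst (z M) \<subseteq> odd_multisets n
      \<and> c M = (\<Sum>N\<in>fst (z M). const_mp (snd (z M) N) * psum_prod n N)" by blast
  define A where "A M = fst (z M)" for M
  define a where "a M = snd (z M)" for M
  have A: "finite (A M)" "A M \<subseteq> odd_multisets n" "c M = (\<Sum>N\<in>A M. const_mp (a M N) * psum_prod n N)"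
    if "M \<in> B" for M
    using z [OF that] by (simp_all add: A_def a_def)
  let ?Z = "(\<lambda>(M, N). (N, M)) ` (SIGMA M : ?S. A M)"
  have "(\<Sum>M\<in>?S. c M * hbasis n M) = (\<Sum>M\<in>?S. \<Sum>N\<in>A M. const_mp (a M N) * family n (N, M))"
    by (intro sum.cong refl) (simp add: A(3) family_def sum_distrib_right mult.assoc)
  also have "\<dots> = (\<Sum>(M, N)\<in>(SIGMA M : ?S. A M). const_mp (a M N) * family n (N, M))"
    using fin A(1) by (intro sum.Sigma) auto
  also have "\<dots> = (\<Sum>x\<in>?Z. const_mp (a (snd x) (fst x)) * family n x)"
    by (subst sum.reindex) (auto simp: inj_on_def intro!: sum.cong)
  finally have "(\<Sum>x\<in>?Z. const_mp (a (snd x) (fst x)) * family n x) = 0" using sum by simp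
  moreover have "finite ?Z" using fin A(1) by (intro finite_imageI finite_SigmaI) auto
  moreover have "?Z \<subseteq> index_set n" using A(2) by (auto simp: index_set_def B_def)
  ultimately have a_0: "a (snd x) (fst x) = 0" if "x \<in> ?Z" for x
    using that by (intro family_independent [where A = ?Z and a = "\<lambda>x. a (snd x) (fst x)"])
  show "c M = 0"
  proof (rule ccontr)
    assume "c M \<noteq> 0"
    hence "M \<in> ?S" using M by simp
    hence "a M N = 0" if "N \<in> A M" for N
      using a_0 [of "(N, M)"] that by force
    hence "c M = 0" using A(3) [OF M] by simp
    thus False using \<open>c M \<noteq> 0\<close> by simp
  qed
qed

end
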